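(* Let $G$ be a group acting on a non-empty set $S$. Then the abstract twisted Brin--Thompson group $SV_G$ is $5$-uniformly perfect, i.e. every element of $SV_G$ is a product of $5$ commutators.
   Context: A group is $n$-uniformly perfect if every element is the product of $n$ commutators. Abstract twisted Brin--Thompson groups. Let $G$ act on the left on a non-empty set $S$ (not necessarily faithfully). Let $C=\{0,1\}^{\mathbb N}$ be the Cantor set, $C^S$ the space of functions $S\to C$ with the product topology, and $C^S(m)$ the disjoint union of $m$ copies of $C^S$ ($m\ge 1$). For $\psi\colon S\to\{0,1\}^*$ (finite words) with $\psi(s)$ empty for all but finitely many $s$, the dyadic brick $B(\psi)$ is $\{\kappa\in C^S\mid \psi(s)\text{ is a prefix of }\kappa(s)\ \forall s\}$, with canonical homeomorphism $h_\psi\colon C^S\to B(\psi)$, $h_\psi(\kappa)(s)=\psi(s)\cdot\kappa(s)$. The Brin--Thompson groupoid $S\mathcal V$ consists of all homeomorphisms $C^S(m)\to C^S(n)$ obtained by partitioning domain and range into the same finite number of dyadic bricks (inside the copies of $C^S$) and mapping domain bricks to range bricks via canonical homeomorphisms $h_\varphi\circ h_\psi^{-1}$. It contains, for $s\in S$, the simple split $x_s\colon C^S\to C^S(2)$ (sending the half where $\kappa(s)$ starts with $0$, resp. $1$, to the first, resp. second, copy by deleting that first letter of $\kappa(s)$), and for $\sigma\in\Sigma_n$ the permutation $p_\sigma$ of the copies in $C^S(n)$ (copy $i$ goes to copy $\sigma(i)$); it has an obvious direct sum $\oplus$ (juxtaposition). The groupoid $S\mathcal V_G$ has objects the positive integers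 and is generated by $S\mathcal V$ together with, for each $n$, a copy of $G^n$ based at the object $n$ (with $(g_1,\dots,g_n)$ also written $g_1\oplus\cdots\oplus g_n$), subject to the set of relations that is closed under compositions and direct sums and contains $x_{g.s}\circ g=(g\oplus g)\circ x_s$ for $s\in S,g\in G$, and $(g_1\oplus\cdots\oplus g_n)\circ p_\sigma=p_\sigma\circ(g_{\sigma(1)}\oplus\cdots\oplus g_{\sigma(n)})$ for $\sigma\in\Sigma_n$, $g_i\in G$. The group $SV_G$ is the group of morphisms of $S\mathcal V_G$ from the object $1$ to itself. (Equivalently, letting $G$ act on $C^S$ by $(g\kappa)(s)=\kappa(g^{-1}.s)$, $SV_G$ is the group of pairs $(h,\gamma)$, $h$ a homeomorphism of $C^S$ and $\gamma\colon C^S\to G$, for which there are finite partitions of $C^S$ into dyadic bricks $B(\psi_1),\dots,B(\psi_n)$ and $B(\varphi_1),\dots,B(\varphi_n)$ and $g_1,\dots,g_n\in G$ with $h|_{B(\psi_i)}=h_{\varphi_i}\circ g_i\circ h_{\psi_i}^{-1}$ and $\gamma|_{B(\psi_i)}\equiv g_i$; the product is $(h,\gamma)(h',\gamma')=(hh',\ \kappa\mapsto\gamma(h'(\kappa))\gamma'(\kappa))$.) *)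

theory Defs
  imports
    "HOL-Algebra.Algebra"
    "HOL-Analysis.Function_Topology"
    "HOL-Library.Omega_Words_Fun"
begin

text \<open>
  The cube \<open>C^S\<close>. Letters \<open>0, 1\<close> are \<^term>\<open>False\<close>, \<^term>\<open>True\<close>, so that
  \<open>C\<close> is the type \<^typ>\<open>bool word\<close> (that is, \<^typ>\<open>nat \<Rightarrow> bool\<close>) with its product topology.
  As everywhere below, functions on a carrier set are taken extensional (undefined outside it),
  so that equality of functions is equality on the carrier.
\<close>

definition cube :: "'s set \<Rightarrow> ('s \<Rightarrow> bool word) set"
  where "cube S = (S \<rightarrow>\<^sub>E UNIV)"

definition cube_topology :: "'s set \<Rightarrow> ('s \<Rightarrow> bool word) topology"
  where "cube_topology S = product_topology (\<lambda>_. euclidean) S"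

text \<open>Addresses \<open>\<psi> : S \<rightarrow> {0,1}*\<close> of dyadic bricks; values outside \<open>S\<close> are irrelevant.\<close>

definition address :: "'s set \<Rightarrow> ('s \<Rightarrow> bool list) \<Rightarrow> bool"
  where "address S \<psi> \<longleftrightarrow> finite {s \<in> S. \<psi> s \<noteq> []}"

definition brick :: "'s set \<Rightarrow> ('s \<Rightarrow> bool list) \<Rightarrow> ('s \<Rightarrow> bool word) set"
  where "brick S \<psi> = {\<kappa> \<in> cube S. \<forall>s\<in>S. Omega_Words_Fun.prefix (length (\<psi> s)) (\<kappa> s) = \<psi> s}"

definition brick_map :: "'s set \<Rightarrow> ('s \<Rightarrow> bool list) \<Rightarrow> ('s \<Rightarrow> bool word) \<Rightarrow> ('s \<Rightarrow> bool word)"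
  where "brick_map S \<psi> \<kappa> = (\<lambda>s\<in>S. \<psi> s \<frown> \<kappa> s)"

definition dyadic_partition :: "'s set \<Rightarrow> nat \<Rightarrow> (nat \<Rightarrow> 's \<Rightarrow> bool list) \<Rightarrow> bool"
  where "dyadic_partition S n \<psi> \<longleftrightarrow>
    (\<forall>i<n. address S (\<psi> i)) \<and>
    disjoint_family_on (\<lambda>i. brick S (\<psi> i)) {..<n} \<and>
    (\<Union>i<n. brick S (\<psi> i)) = cube S"

definition cube_action ::
    "('g, 'm) monoid_scheme \<Rightarrow> 's set \<Rightarrow> ('g \<Rightarrow> 's \<Rightarrow> 's) \<Rightarrow> 'g \<Rightarrow> ('s \<Rightarrow> bool word) \<Rightarrow> ('s \<Rightarrow> bool word)"
  where "cube_action G S act g \<kappa> = (\<lambda>s\<in>S. \<kappa> (act (inv\<^bsub>G\<^esub> g) s))"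

text \<open>
  The abstract twisted Brin--Thompson group \<open>SV_G\<close>, as the group of pairs \<open>(h, \<gamma>)\<close> of a
  homeomorphism of the cube and a labelling of its points by elements of \<open>G\<close>.
  The condition \<open>h = h_\<phi> \<circ> g \<circ> h_\<psi>\<^sup>-\<^sup>1\<close> on the brick of \<open>\<psi>\<close> is
  expressed at the points \<open>h_\<psi>(\<kappa>)\<close> of that brick.
\<close>

definition twisted_brin_thompson ::
    "('g, 'm) monoid_scheme \<Rightarrow> 's set \<Rightarrow> ('g \<Rightarrow> 's \<Rightarrow> 's) \<Rightarrow>
     ((('s \<Rightarrow> bool word) \<Rightarrow> ('s \<Rightarrow> bool word)) \<times> (('s \<Rightarrow> bool word) \<Rightarrow> 'g)) monoid"
  where "twisted_brin_thompson G S act =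
    \<lparr>carrier = {(h, \<gamma>).
       h \<in> extensional (cube S) \<and>
       homeomorphic_map (cube_topology S) (cube_topology S) h \<and>
       \<gamma> \<in> cube S \<rightarrow>\<^sub>E carrier G \<and>
       (\<exists>n \<psi> \<phi> g. dyadic_partition S n \<psi> \<and> dyadic_partition S n \<phi> \<and>
          (\<forall>i<n. g i \<in> carrier G \<and>
             (\<forall>\<kappa>\<in>cube S.
                h (brick_map S (\<psi> i) \<kappa>) = brick_map S (\<phi> i) (cube_action G S act (g i) \<kappa>) \<and>
                \<gamma> (brick_map S (\<psi> i) \<kappa>) = g i)))},
     monoid.mult = (\<lambda>(h, \<gamma>) (h', \<gamma>').
       (compose (cube S) h h', \<lambda>\<kappa>\<in>cube S. \<gamma> (h' \<kappa>) \<otimes>\<^bsub>G\<^esub> \<gamma>' \<kappa>)),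
     one = (\<lambda>\<kappa>\<in>cube S. \<kappa>, \<lambda>\<kappa>\<in>cube S. \<one>\<^bsub>G\<^esub>)\<rparr>"

text \<open>\<^term>\<open>derived_set G (carrier G)\<close> is the set of commutators of \<open>G\<close>.\<close>

definition uniformly_perfect :: "nat \<Rightarrow> ('a, 'b) monoid_scheme \<Rightarrow> bool"
  where "uniformly_perfect n G \<longleftrightarrow> group G \<and>
    (\<forall>x\<in>carrier G. \<exists>cs. length cs = n \<and> set cs \<subseteq> derived_set G (carrier G) \<and>
       x = foldr (\<otimes>\<^bsub>G\<^esub>) cs \<one>\<^bsub>G\<^esub>)"

end

theory Submission
  imports Defs
begin

text \<open>
  An element of \<open>SV\<^sub>G\<close> is treated as a permutation of the points \<open>(\<kappa>, x)\<close>, \<open>\<kappa>\<close> in the cube and \<open>x\<close> a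
  label, namely \<open>(\<kappa>, x) \<mapsto> (h \<kappa>, \<gamma>(\<kappa>) x)\<close>; then \<open>G\<close> and the canonical maps of bricks become
  self-maps \<open>twist g\<close> and \<open>graft \<psi>\<close> of one set, and multiplication is composition. Points range over
  a whole type: coordinates outside \<open>S\<close> and labels outside \<open>G\<close> are carried along unchanged.

  A transposition of two disjoint bricks is a commutator: it is the product of the
  transposition of their first halves and that of their second halves, which are conjugate
  involutions. Modulo commutators an element copied into a brick does not depend on the brick.
  Hence \<open>x\<^bsub>g.s\<^esub> g = (g \<oplus> g) x\<^sub>s\<close> and the commutation of splits in different coordinates show that the
  elements of \<open>G\<close> and the changes of split coordinate are products of commutators. Modulo
  commutators the source and target partitions of a table may therefore both be refined to a grid
  and mapped onto the comb \<open>1, 01, 001, \<dots>\<close> in one coordinate, so the group is perfect.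

  If \<open>f\<close> is supported in a half of the cube and is a product of commutators \<open>c\<^sub>1 \<dots> c\<^sub>k\<close> there, spreading the
  tails \<open>c\<^sub>i \<dots> c\<^sub>k\<close> over disjoint translates of its support by an element \<open>t\<close> writes \<open>f\<close> as a commutator with \<open>t\<close>
  times one simultaneous commutator. An arbitrary element agrees on some small brick with a
  product of two (labelled) transpositions, and the remaining factor fixes a brick, so it is
  conjugate into a half: four commutators suffice.
\<close>

section \<open>Products of commutators\<close>

context group
begin

lemma inv_cancel_left [simp]:
  "x \<in> carrier G \<Longrightarrow> y \<in> carrier G \<Longrightarrow> inv x \<otimes> (x \<otimes> y) = y"
  "x \<in> carrier G \<Longrightarrow> y \<in> carrier G \<Longrightarrow> x \<otimes> (inv x \<otimes> y) = y"
  by (simp_all flip: m_assoc)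

text \<open>Exactly \<open>n\<close> factors, in the form used by \<open>uniformly_perfect\<close>;
  shorter products are padded with trivial commutators, see
  \<open>commutator_product_Suc\<close>.\<close>

definition commutator_product :: "nat \<Rightarrow> 'a \<Rightarrow> bool"
  where "commutator_product n x \<longleftrightarrow>
    (\<exists>cs. length cs = n \<and> set cs \<subseteq> derived_set G (carrier G) \<and> x = foldr (\<otimes>) cs \<one>)"

lemma derived_setI:
  "a \<in> carrier G \<Longrightarrow> b \<in> carrier G \<Longrightarrow> x = a \<otimes> b \<otimes> inv a \<otimes> inv b \<Longrightarrow>
    x \<in> derived_set G (carrier G)"
  by blast

lemma derived_closed: "x \<in> derived G (carrier G) \<Longrightarrow> x \<in> carrier G"
  using derived_in_carrier by blast

lemma derived_set_in_derived: "x \<in> derived_set G (carrier G) \<Longrightarrow> x \<in> derived G (carrier G)"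
  unfolding derived_def by (rule generate.incl)

lemma derived_mult:
  "x \<in> derived G (carrier G) \<Longrightarrow> y \<in> derived G (carrier G) \<Longrightarrow> x \<otimes> y \<in> derived G (carrier G)"
  unfolding derived_def by (rule generate.eng)

lemma derived_inv:
  "x \<in> derived G (carrier G) \<Longrightarrow> inv x \<in> derived G (carrier G)"
  by (simp add: derived_is_subgroup subgroup.m_inv_closed)

lemma derived_one: "\<one> \<in> derived G (carrier G)"
  unfolding derived_def by (rule generate.one)

text \<open>The conjugate of x by g is the commutator of g and x, times x.\<close>

lemma derived_conj:
  assumes "x \<in> derived G (carrier G)" "g \<in> carrier G"
  shows "g \<otimes> x \<otimes> inv g \<in> derived G (carrier G)"
proof -
  have x: "x \<in> carrier G"
    using assms derived_closed by simp
  have "g \<otimes> x \<otimes> inv g \<otimes> inv x \<in> derived G (carrier G)"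
    using assms x by (intro derived_set_in_derived derived_setI) auto
  from derived_mult[OF this assms(1)] show ?thesis
    using assms x by (simp add: m_assoc)
qed

lemma foldr_mult_closed: "set cs \<subseteq> carrier G \<Longrightarrow> foldr (\<otimes>) cs \<one> \<in> carrier G"
  by (induction cs) auto

lemma foldr_mult_append:
  "set xs \<subseteq> carrier G \<Longrightarrow> set ys \<subseteq> carrier G \<Longrightarrow>
    foldr (\<otimes>) (xs @ ys) \<one> = foldr (\<otimes>) xs \<one> \<otimes> foldr (\<otimes>) ys \<one>"
  by (induction xs) (auto simp: m_assoc foldr_mult_closed simp del: foldr_append)

lemma commutator_product_mult:
  assumes "commutator_product m x" "commutator_product n y"
  shows "commutator_product (m + n) (x \<otimes> y)"
proof -
  obtain xs ys where "length xs = m" "set xs \<subseteq> derived_set G (carrier G)" "x = foldr (\<otimes>) xs \<one>"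
    and "length ys = n" "set ys \<subseteq> derived_set G (carrier G)" "y = foldr (\<otimes>) ys \<one>"
    using assms unfolding commutator_product_def by blast
  then show ?thesis
    unfolding commutator_product_def
    by (intro exI[of _ "xs @ ys"]) (subst foldr_mult_append; force)
qed

lemma commutator_product_1: "x \<in> derived_set G (carrier G) \<Longrightarrow> commutator_product 1 x"
  unfolding commutator_product_def by (intro exI[of _ "[x]"]) auto

lemma commutator_product_closed: "commutator_product n x \<Longrightarrow> x \<in> carrier G"
  unfolding commutator_product_def
  using foldr_mult_closed derived_set_in_carrier[of "carrier G"] by blast

lemma commutator_product_Suc:
  assumes "commutator_product n x" shows "commutator_product (Suc n) x"
proof -
  have "\<one> \<in> derived_set G (carrier G)"
    by (rule derived_setI[of \<one> \<one>]) auto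
  from commutator_product_mult[OF commutator_product_1[OF this] assms] show ?thesis
    using commutator_product_closed[OF assms] by simp
qed

lemma derived_set_conj:
  assumes "x \<in> derived_set G (carrier G)" "g \<in> carrier G"
  shows "g \<otimes> x \<otimes> inv g \<in> derived_set G (carrier G)"
proof -
  obtain a b where "a \<in> carrier G" "b \<in> carrier G" "x = a \<otimes> b \<otimes> inv a \<otimes> inv b"
    using assms by blast
  then show ?thesis
    using assms(2)
    by (intro derived_setI[of "g \<otimes> a \<otimes> inv g" "g \<otimes> b \<otimes> inv g"]) (auto simp: m_assoc inv_mult_group)
qed

lemma commutator_product_conj:
  assumes "commutator_product n x" "g \<in> carrier G"
  shows "commutator_product n (g \<otimes> x \<otimes> inv g)"
proof -
  obtain cs where cs: "length cs = n" "set cs \<subseteq> derived_set G (carrier G)" "x = foldr (\<otimes>) cs \<one>"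
    using assms unfolding commutator_product_def by blast
  have "g \<otimes> foldr (\<otimes>) cs \<one> \<otimes> inv g = foldr (\<otimes>) (map (\<lambda>c. g \<otimes> c \<otimes> inv g) cs) \<one>"
    using cs(2)
  proof (induction cs)
    case (Cons c cs)
    moreover from this have "foldr (\<otimes>) cs \<one> \<in> carrier G" "c \<in> carrier G"
      by (auto intro!: foldr_mult_closed)
    ultimately show ?case
      using assms(2) by (simp add: m_assoc flip: Cons.IH)
  qed (use assms in simp)
  moreover have "set (map (\<lambda>c. g \<otimes> c \<otimes> inv g) cs) \<subseteq> derived_set G (carrier G)"
    unfolding set_map by (rule image_subsetI) (rule derived_set_conj[OF subsetD[OF cs(2)] assms(2)])
  ultimately show ?thesis
    using cs unfolding commutator_product_def
    by (intro exI[of _ "map (\<lambda>c. g \<otimes> c \<otimes> inv g) cs"]) (simp only: length_map)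
qed

lemma derived_set_inv:
  assumes "x \<in> derived_set G (carrier G)" shows "inv x \<in> derived_set G (carrier G)"
proof -
  obtain a b where "a \<in> carrier G" "b \<in> carrier G" "x = a \<otimes> b \<otimes> inv a \<otimes> inv b"
    using assms by blast
  then show ?thesis
    by (intro derived_setI[of b a]) (auto simp: m_assoc inv_mult_group)
qed

lemma derived_commutator_product:
  assumes "x \<in> derived G (carrier G)" shows "\<exists>n. commutator_product n x"
  using assms unfolding derived_def
proof (induction rule: generate.induct)
  case one
  show ?case
    unfolding commutator_product_def by (intro exI[of _ 0] exI[of _ "[]"]) auto
next
  case (eng x y)
  then show ?case
    using commutator_product_mult by blast
qed (blast intro: commutator_product_1 derived_set_inv)+

lemma hom_derived:
  assumes E: "E \<in> hom G G" and "x \<in> derived G (carrier G)"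
  shows "E x \<in> derived G (carrier G)"
proof -
  interpret E: group_hom G G E
    using E by unfold_locales
  have com: "E y \<in> derived G (carrier G)" if y: "y \<in> derived_set G (carrier G)" for y
  proof -
    obtain a b where "a \<in> carrier G" "b \<in> carrier G" "y = a \<otimes> b \<otimes> inv a \<otimes> inv b"
      using y by blast
    then show ?thesis
      by (intro derived_set_in_derived derived_setI[of "E a" "E b"]) auto
  qed
  \<comment> \<open>Membership of x in the carrier is carried through the induction because the
    homomorphism laws require it.\<close>
  have "E x \<in> derived G (carrier G) \<and> x \<in> carrier G"
    using assms(2) unfolding derived_def[of G "carrier G"]
  proof (induction rule: generate.induct)
    case (inv h)
    then have "h \<in> carrier G" by auto
    then show ?case
      using derived_inv[OF com[OF inv]] by (simp add: derived_def)
  next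
    case (incl h)
    then have "h \<in> carrier G" by auto
    then show ?case
      using com[OF incl] by (simp add: derived_def)
  next
    case (eng x y)
    then show ?case
      using derived_mult by (simp add: derived_def)
  qed (use derived_one in \<open>auto simp: derived_def\<close>)
  then show ?thesis ..
qed

end

section \<open>Groups containing two commuting copies of themselves\<close>

text \<open>
  Read \<open>E\<^sub>0\<close> and \<open>E\<^sub>1\<close> as conjugation into the two halves of the cube, and \<open>t\<close> as an element
  squeezing the half \<open>0\<close> onto the quarter \<open>00\<close>: the bricks \<open>01\<close>, \<open>001\<close>, \<open>0001\<close>, \dots are
  successive disjoint translates under \<open>t\<close>.
\<close>

locale halved_group = group G for G (structure) +
  fixes E\<^sub>0 E\<^sub>1 :: "'a \<Rightarrow> 'a" and t u w :: 'a
  assumes E0_hom: "E\<^sub>0 \<in> hom G G" and E1_hom: "E\<^sub>1 \<in> hom G G"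
    and E01_comm: "x \<in> carrier G \<Longrightarrow> y \<in> carrier G \<Longrightarrow> E\<^sub>0 x \<otimes> E\<^sub>1 y = E\<^sub>1 y \<otimes> E\<^sub>0 x"
    and t_closed: "t \<in> carrier G"
    and t_conj: "x \<in> carrier G \<Longrightarrow> t \<otimes> E\<^sub>0 x \<otimes> inv t = E\<^sub>0 (E\<^sub>0 x)"
    and u_closed: "u \<in> carrier G"
    and u_conj: "x \<in> carrier G \<Longrightarrow> u \<otimes> E\<^sub>0 x \<otimes> inv u = E\<^sub>0 (E\<^sub>1 x)"
    and w_closed: "w \<in> carrier G"
    and w_conj: "x \<in> carrier G \<Longrightarrow> w \<otimes> E\<^sub>0 x \<otimes> inv w = E\<^sub>1 x"
begin

sublocale E0: group_hom G G E\<^sub>0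
  using E0_hom by unfold_locales

sublocale E1: group_hom G G E\<^sub>1
  using E1_hom by unfold_locales

text \<open>Counting from 0, the i-th entry acts on the brick 0...01 with i zeros; what remains at
  the end carries the identity.\<close>

fun spread :: "'a list \<Rightarrow> 'a" where
  "spread [] = \<one>"
| "spread (f # fs) = E\<^sub>1 f \<otimes> E\<^sub>0 (spread fs)"

lemma spread_closed: "set fs \<subseteq> carrier G \<Longrightarrow> spread fs \<in> carrier G"
  by (induction fs) auto

text \<open>The two halves commute, so pairs multiply componentwise. With \<open>halves_inv\<close>,
  calculations in the two halves run in parallel.\<close>

lemma halves_mult:
  assumes "a \<in> carrier G" "b \<in> carrier G" "c \<in> carrier G" "d \<in> carrier G"
  shows "(E\<^sub>1 a \<otimes> E\<^sub>0 b) \<otimes> (E\<^sub>1 c \<otimes> E\<^sub>0 d) = E\<^sub>1 (a \<otimes> c) \<otimes> E\<^sub>0 (b \<otimes> d)"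
proof -
  have "(E\<^sub>1 a \<otimes> E\<^sub>0 b) \<otimes> (E\<^sub>1 c \<otimes> E\<^sub>0 d) = E\<^sub>1 a \<otimes> ((E\<^sub>0 b \<otimes> E\<^sub>1 c) \<otimes> E\<^sub>0 d)"
    using assms by (simp add: m_assoc)
  also have "\<dots> = E\<^sub>1 (a \<otimes> c) \<otimes> E\<^sub>0 (b \<otimes> d)"
    unfolding E01_comm[OF assms(2,3)] using assms by (simp add: m_assoc)
  finally show ?thesis .
qed

lemma halves_inv:
  assumes "a \<in> carrier G" "b \<in> carrier G"
  shows "inv (E\<^sub>1 a \<otimes> E\<^sub>0 b) = E\<^sub>1 (inv a) \<otimes> E\<^sub>0 (inv b)"
  using assms E01_comm[of "inv b" "inv a"] by (simp add: inv_mult_group)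

text \<open>This is the compression step: commutators placed on disjoint bricks are formed
  simultaneously, as the commutator of the two spread lists of their entries.\<close>

lemma spread_derived_set:
  "set cs \<subseteq> derived_set G (carrier G) \<Longrightarrow> spread cs \<in> derived_set G (carrier G)"
proof (induction cs)
  case Nil
  show ?case
    by (rule derived_setI[of \<one> \<one>]) auto
next
  case (Cons c cs)
  obtain a b where ab: "a \<in> carrier G" "b \<in> carrier G" "c = a \<otimes> b \<otimes> inv a \<otimes> inv b"
    using Cons.prems by auto
  have "spread cs \<in> derived_set G (carrier G)"
    using Cons by simp
  then obtain h k where hk: "h \<in> carrier G" "k \<in> carrier G" "spread cs = h \<otimes> k \<otimes> inv h \<otimes> inv k"
    by auto
  show ?case
    using ab hk
    by (intro derived_setI[of "E\<^sub>1 a \<otimes> E\<^sub>0 h" "E\<^sub>1 b \<otimes> E\<^sub>0 k"])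
      (simp_all add: halves_mult halves_inv del: E0.hom_mult E1.hom_mult E0.hom_inv E1.hom_inv)
qed

text \<open>The witness \<open>F\<close> carries the tails c_1...c_k, c_2...c_k, ... on the bricks
  01, 001, ..., and conjugation by \<open>t\<close> shifts them one brick further. In the commutator
  of \<open>F\<close> and \<open>t\<close> the brick 01 therefore keeps the full product, and each
  later brick keeps the quotient of two neighbouring tails, the inverse of some c_i. The last factor
  cancels these inverses.\<close>

lemma telescope:
  assumes "set cs \<subseteq> carrier G"
  shows "\<exists>F\<in>carrier G. E\<^sub>0 (E\<^sub>1 (foldr (\<otimes>) cs \<one>)) =
    (F \<otimes> t \<otimes> inv F \<otimes> inv t) \<otimes> (t \<otimes> E\<^sub>0 (spread cs) \<otimes> inv t)"
  using assms
proof (induction cs)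
  case Nil
  show ?case
    using t_closed by (intro bexI[of _ \<one>]) auto
next
  case (Cons c cs)
  define f' where "f' = foldr (\<otimes>) cs \<one>"
  define q where "q = E\<^sub>0 (E\<^sub>0 (spread cs))"
  have c: "c \<in> carrier G" and f': "f' \<in> carrier G" and s: "spread cs \<in> carrier G"
    and q: "q \<in> carrier G"
    using Cons.prems by (auto simp: f'_def q_def foldr_mult_closed spread_closed)
  have qt: "t \<otimes> E\<^sub>0 (spread cs) \<otimes> inv t = q"
    using t_conj[OF s] by (simp add: q_def)
  obtain F where F: "F \<in> carrier G"
    and eq: "E\<^sub>0 (E\<^sub>1 f') = (F \<otimes> t \<otimes> inv F \<otimes> inv t) \<otimes> q"
    using Cons by (auto simp: f'_def qt)
  \<comment> \<open>\<open>q\<close> lives in the quarter 00, the other factor in the quarter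
    01.\<close>
  have q_comm: "inv q \<otimes> E\<^sub>0 (E\<^sub>1 x) = E\<^sub>0 (E\<^sub>1 x) \<otimes> inv q" if "x \<in> carrier G" for x
    using E01_comm[of "inv (spread cs)" x] that s unfolding q_def
    by (simp flip: E0.hom_mult E0.hom_inv)
  have telescoped: "F \<otimes> t \<otimes> inv F \<otimes> inv t = E\<^sub>0 (E\<^sub>1 f') \<otimes> inv q"
    using eq F q t_closed by (simp add: m_assoc)
  \<comment> \<open>The new full product goes on the brick 01, and the tails already placed by
    \<open>F\<close> move one brick along.\<close>
  define F' where "F' = E\<^sub>0 (E\<^sub>1 (c \<otimes> f')) \<otimes> (t \<otimes> F \<otimes> inv t)"
  have F': "F' \<in> carrier G"
    using F c f' t_closed by (simp add: F'_def)
  have "F' \<otimes> t \<otimes> inv F' \<otimes> inv t =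
      E\<^sub>0 (E\<^sub>1 (c \<otimes> f')) \<otimes> t \<otimes> (F \<otimes> t \<otimes> inv F \<otimes> inv t) \<otimes> inv (E\<^sub>0 (E\<^sub>1 (c \<otimes> f'))) \<otimes> inv t"
    using F c f' t_closed by (simp add: F'_def m_assoc inv_mult_group del: E0.hom_mult E1.hom_mult)
  also have "\<dots> = E\<^sub>0 (E\<^sub>1 (c \<otimes> f')) \<otimes> t \<otimes> E\<^sub>0 (E\<^sub>1 f') \<otimes> (inv q \<otimes> E\<^sub>0 (E\<^sub>1 (inv (c \<otimes> f')))) \<otimes> inv t"
    unfolding telescoped using c f' q t_closed by (simp add: m_assoc del: E0.hom_mult E1.hom_mult)
  also have "\<dots> = E\<^sub>0 (E\<^sub>1 (c \<otimes> f')) \<otimes> t \<otimes> inv (E\<^sub>0 (E\<^sub>1 c)) \<otimes> inv q \<otimes> inv t"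
    using c f' q t_closed by (subst q_comm) (simp_all add: m_assoc inv_mult_group)
  finally have "E\<^sub>0 (E\<^sub>1 (c \<otimes> f')) =
      (F' \<otimes> t \<otimes> inv F' \<otimes> inv t) \<otimes> (t \<otimes> (q \<otimes> E\<^sub>0 (E\<^sub>1 c)) \<otimes> inv t)"
    using c f' q t_closed by (simp add: m_assoc)
  also have "q \<otimes> E\<^sub>0 (E\<^sub>1 c) = E\<^sub>0 (spread (c # cs))"
    using E01_comm[of "spread cs" c] c s unfolding q_def by (simp flip: E0.hom_mult)
  finally show ?case
    using F' unfolding f'_def by auto
qed

text \<open>However many commutators x needs, two suffice for its copy in a half:
  \<open>telescope\<close> gives a commutator with \<open>t\<close> and a conjugate of a spread list
  of commutators, which is a single commutator by \<open>spread_derived_set\<close>.\<close>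

theorem commutator_product_half:
  assumes "x \<in> derived G (carrier G)" shows "commutator_product 2 (E\<^sub>0 x)"
proof -
  obtain cs where cs: "set cs \<subseteq> derived_set G (carrier G)" "x = foldr (\<otimes>) cs \<one>"
    using derived_commutator_product[OF assms] unfolding commutator_product_def by blast
  have cs': "set cs \<subseteq> carrier G"
    using cs(1) derived_set_in_carrier[of "carrier G"] by blast
  have x: "x \<in> carrier G"
    using assms by (rule derived_closed)
  obtain F where F: "F \<in> carrier G"
    "E\<^sub>0 (E\<^sub>1 x) = (F \<otimes> t \<otimes> inv F \<otimes> inv t) \<otimes> (t \<otimes> E\<^sub>0 (spread cs) \<otimes> inv t)"
    using telescope[OF cs'] cs(2) by blast
  \<comment> \<open>An additional first entry 1 leaves the brick 1 alone and pushes the list into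
    the half 0, so the pushed element is itself a spread list.\<close>
  have "spread (\<one> # cs) \<in> derived_set G (carrier G)"
    using derived_setI[of \<one> \<one> \<one>] cs(1) by (intro spread_derived_set) simp
  moreover have "spread (\<one> # cs) = E\<^sub>0 (spread cs)"
    using spread_closed[OF cs'] by simp
  ultimately have "E\<^sub>0 (spread cs) \<in> derived_set G (carrier G)"
    by (simp only:)
  note tE = derived_set_conj[OF this t_closed]
  have "F \<otimes> t \<otimes> inv F \<otimes> inv t \<in> derived_set G (carrier G)"
    using F(1) t_closed by (rule derived_setI) (rule refl)
  from commutator_product_mult[OF this[THEN commutator_product_1] tE[THEN commutator_product_1]]
  have "commutator_product (1 + 1) (E\<^sub>0 (E\<^sub>1 x))"
    unfolding F(2) .
  \<comment> \<open>Conjugation by the inverse of \<open>u\<close> enlarges the quarter 01 back to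
    the half 0.\<close>
  then have "commutator_product 2 (inv u \<otimes> (E\<^sub>0 (E\<^sub>1 x)) \<otimes> inv (inv u))"
    using u_closed by (intro commutator_product_conj) (auto simp: numeral_2_eq_2)
  then show ?thesis
    using x u_closed by (simp add: m_assoc flip: u_conj)
qed

text \<open>In the abelianization the hypothesis reads \<open>x = 2 E\<^sub>0 x\<close>, and hence \<open>E\<^sub>0 x = 2 E\<^sub>0 x\<close>.\<close>

lemma derived_if_doubled:
  assumes x: "x \<in> carrier G" and n: "n \<in> derived G (carrier G)" and eq: "x = n \<otimes> E\<^sub>0 x \<otimes> E\<^sub>1 x"
  shows "x \<in> derived G (carrier G)"
proof -
  let ?D = "derived G (carrier G)"
  define a where "a = E\<^sub>0 x"
  define m where "m = E\<^sub>0 n"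
  have a: "a \<in> carrier G" and mD: "m \<in> ?D" and m: "m \<in> carrier G"
    using x n by (auto simp: a_def m_def hom_derived[OF E0_hom] derived_closed)
  have com: "y \<otimes> a \<otimes> inv y \<otimes> inv a \<in> ?D" if "y \<in> carrier G" for y
    using that a by (intro derived_set_in_derived derived_setI) auto
  define c where "c = t \<otimes> a \<otimes> inv t \<otimes> inv a"
  define d where "d = u \<otimes> a \<otimes> inv u \<otimes> inv a"
  have c: "c \<in> carrier G" "c \<in> ?D" and d: "d \<in> carrier G" "d \<in> ?D"
    using a com t_closed u_closed by (auto simp: c_def d_def)
  \<comment> \<open>Applying \<open>E\<^sub>0\<close> to the hypothesis turns both copies of x into
    conjugates of \<open>a\<close>, by \<open>t\<close> and by \<open>u\<close>. They equal c a and
    d a with commutators c and d, and cancelling one \<open>a\<close> isolates the other.\<close>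
  have "a = E\<^sub>0 (n \<otimes> E\<^sub>0 x \<otimes> E\<^sub>1 x)"
    using eq by (simp add: a_def)
  also have "\<dots> = m \<otimes> (t \<otimes> a \<otimes> inv t) \<otimes> (u \<otimes> a \<otimes> inv u)"
    unfolding a_def m_def t_conj[OF x] u_conj[OF x] using x derived_closed[OF n] by simp
  also have "\<dots> = (m \<otimes> c \<otimes> a \<otimes> d) \<otimes> a"
    using a m t_closed u_closed by (simp add: c_def d_def m_assoc)
  finally have "m \<otimes> c \<otimes> a \<otimes> d = \<one>"
    using a m c(1) d(1) by (metis l_cancel_one' m_closed r_cancel_one')
  then have "a = inv (m \<otimes> c) \<otimes> inv d"
    using a m c(1) d(1) by (metis inv_closed inv_solve_left inv_solve_right l_one m_assoc m_closed r_one)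
  then have "a \<in> ?D"
    using mD c(2) d(2) by (simp add: derived_mult derived_inv)
  then have "E\<^sub>1 x \<in> ?D"
    using derived_conj[OF _ w_closed] w_conj[OF x] unfolding a_def by metis
  then show ?thesis
    using \<open>a \<in> ?D\<close> n by (subst eq) (simp add: derived_mult a_def)
qed

end

section \<open>Bricks and the elements they support\<close>

type_synonym ('s, 'g) point = "('s \<Rightarrow> bool word) \<times> 'g"

text \<open>The canonical map of the brick of \<beta>, on labelled points; the label is
  kept.\<close>

definition graft :: "('s \<Rightarrow> bool list) \<Rightarrow> ('s, 'g) point \<Rightarrow> ('s, 'g) point"
  where "graft \<beta> z = (\<lambda>s. \<beta> s \<frown> fst z s, snd z)"

definition cat :: "('s \<Rightarrow> bool list) \<Rightarrow> ('s \<Rightarrow> bool list) \<Rightarrow> 's \<Rightarrow> bool list"  (infixr "\<star>" 75)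
  where "\<alpha> \<star> \<beta> = (\<lambda>s. \<alpha> s @ \<beta> s)"

definition word_at :: "'s \<Rightarrow> bool list \<Rightarrow> 's \<Rightarrow> bool list"
  where "word_at s w = (\<lambda>_. [])(s := w)"

text \<open>Disjointness of bricks, expressed by their addresses; see
  \<open>apart_iff_disjoint\<close>.\<close>

definition apart :: "('s \<Rightarrow> bool list) \<Rightarrow> ('s \<Rightarrow> bool list) \<Rightarrow> bool"
  where "apart \<alpha> \<beta> \<longleftrightarrow> (\<exists>s. \<exists>i < min (length (\<alpha> s)) (length (\<beta> s)). \<alpha> s ! i \<noteq> \<beta> s ! i)"

abbreviation triv :: "'s \<Rightarrow> bool list"
  where "triv \<equiv> (\<lambda>_. [])"

abbreviation invf :: "('a \<Rightarrow> 'b) \<Rightarrow> 'b \<Rightarrow> 'a"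
  where "invf \<equiv> inv_into UNIV"

definition emb :: "('s \<Rightarrow> bool list) \<Rightarrow> (('s, 'g) point \<Rightarrow> ('s, 'g) point) \<Rightarrow> ('s, 'g) point \<Rightarrow> ('s, 'g) point"
  where "emb \<beta> F z = (if z \<in> range (graft \<beta>) then graft \<beta> (F (invf (graft \<beta>) z)) else z)"

definition swp :: "('s \<Rightarrow> bool list) \<Rightarrow> ('s \<Rightarrow> bool list) \<Rightarrow> ('s, 'g) point \<Rightarrow> ('s, 'g) point"
  where "swp \<alpha> \<beta> z =
    (if z \<in> range (graft \<alpha>) then graft \<beta> (invf (graft \<alpha>) z)
     else if z \<in> range (graft \<beta>) then graft \<alpha> (invf (graft \<beta>) z) else z)"

text \<open>The element that splits in coordinate s and merges in coordinate s': the first letter at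
  s is removed there and put in front at s'.\<close>

definition rebase :: "'s \<Rightarrow> 's \<Rightarrow> ('s, 'g) point \<Rightarrow> ('s, 'g) point"
  where "rebase s s' z = graft (word_at s' [fst z s 0]) (invf (graft (word_at s [fst z s 0])) z)"

section \<open>Addresses and the bricks they determine\<close>

lemma conc_eq_prefix: "(\<exists>w. x = u \<frown> w) \<longleftrightarrow> (\<forall>i<length u. x i = u ! i)"
proof
  assume *: "\<forall>i<length u. x i = u ! i"
  have "x = u \<frown> (\<lambda>n. x (n + length u))"
    using * by (auto simp: fun_eq_iff conc_def)
  then show "\<exists>w. x = u \<frown> w"
    by blast
qed auto

lemma range_graft: "z \<in> range (graft \<beta>) \<longleftrightarrow> (\<forall>s. \<forall>i<length (\<beta> s). fst z s i = \<beta> s ! i)"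
proof -
  have "z \<in> range (graft \<beta>) \<longleftrightarrow> (\<forall>s. \<exists>w. fst z s = \<beta> s \<frown> w)"
  proof
    assume "\<forall>s. \<exists>w. fst z s = \<beta> s \<frown> w"
    then obtain f where "\<And>s. fst z s = \<beta> s \<frown> f s"
      by metis
    then have "z = graft \<beta> (f, snd z)"
      by (auto simp: graft_def prod_eq_iff)
    then show "z \<in> range (graft \<beta>)"
      by blast
  qed (auto simp: graft_def)
  then show ?thesis
    by (simp add: conc_eq_prefix)
qed

lemma inj_graft [simp]: "inj (graft \<beta>)"
proof (rule injI)
  fix y z :: "('a, 'b) point"
  assume "graft \<beta> y = graft \<beta> z"
  then have "\<beta> s \<frown> fst y s = \<beta> s \<frown> fst z s" and "snd y = snd z" for s
    by (auto simp: graft_def dest: fun_cong)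
  then show "y = z"
    by (auto simp: prod_eq_iff)
qed

lemma graft_eq_iff [simp]: "graft \<beta> y = graft \<beta> z \<longleftrightarrow> y = z"
  using inj_graft by (rule inj_eq)

lemma graft_triv [simp]: "graft triv = id"
  by (auto simp: graft_def)

lemma graft_cat: "graft (\<alpha> \<star> \<beta>) = graft \<alpha> \<circ> graft \<beta>"
  by (auto simp: graft_def cat_def)

lemma graft_cat_apply: "graft (\<alpha> \<star> \<beta>) z = graft \<alpha> (graft \<beta> z)"
  by (simp add: graft_cat)

lemma cat_triv [simp]: "\<alpha> \<star> triv = \<alpha>" "triv \<star> \<alpha> = \<alpha>"
  by (auto simp: cat_def)

lemma cat_assoc: "(\<alpha> \<star> \<beta>) \<star> \<gamma> = \<alpha> \<star> \<beta> \<star> \<gamma>"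
  by (auto simp: cat_def)

lemma word_at_Nil [simp]: "word_at s [] = triv"
  by (auto simp: word_at_def)

lemma word_at_cat [simp]: "word_at s u \<star> word_at s v = word_at s (u @ v)"
  by (auto simp: word_at_def cat_def)

lemma word_at_cat_commute: "s \<noteq> t \<Longrightarrow> word_at s u \<star> word_at t v = word_at t v \<star> word_at s u"
  by (auto simp: word_at_def cat_def)

lemma apart_sym: "apart \<alpha> \<beta> \<longleftrightarrow> apart \<beta> \<alpha>"
  unfolding apart_def by (metis min.commute)

lemma apart_iff_disjoint:
  "apart \<alpha> \<beta> \<longleftrightarrow> range (graft \<alpha> :: ('s, 'g) point \<Rightarrow> _) \<inter> range (graft \<beta>) = {}"
proof
  assume "range (graft \<alpha> :: ('s, 'g) point \<Rightarrow> _) \<inter> range (graft \<beta>) = {}"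
  \<comment> \<open>This point reads the words of \<alpha>, continued by the surplus letters of
    \<beta>. It always lies in the brick of \<alpha>, and it misses the brick of \<beta> only where
    the two words disagree.\<close>
  moreover define z :: "('s, 'g) point" where
    "z = (\<lambda>s i. if i < length (\<alpha> s) then \<alpha> s ! i else if i < length (\<beta> s) then \<beta> s ! i else False, undefined)"
  have "z \<in> range (graft \<alpha>)"
    by (auto simp: range_graft z_def)
  ultimately have "z \<notin> range (graft \<beta>)"
    by blast
  then show "apart \<alpha> \<beta>"
    unfolding apart_def by (auto simp: range_graft z_def split: if_splits)
next
  assume "apart \<alpha> \<beta>"
  then obtain s i where "i < length (\<alpha> s)" "i < length (\<beta> s)" "\<alpha> s ! i \<noteq> \<beta> s ! i"
    unfolding apart_def by auto
  then show "range (graft \<alpha> :: ('s, 'g) point \<Rightarrow> _) \<inter> range (graft \<beta>) = {}"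
    unfolding disjoint_iff range_graft by metis
qed

lemma apart_graft:
  fixes y z :: "('s, 'g) point"
  shows "apart \<alpha> \<beta> \<Longrightarrow> graft \<alpha> y \<noteq> graft \<beta> z"
  unfolding apart_iff_disjoint[where 'g = 'g] by blast

lemma apart_notin: "apart \<alpha> \<beta> \<Longrightarrow> graft \<alpha> y \<notin> range (graft \<beta>)"
  using apart_graft by blast

lemma apart_irrefl [simp]: "\<not> apart \<alpha> \<alpha>"
  by (simp add: apart_def)

lemma apart_cat_iff [simp]: "apart (\<alpha> \<star> \<beta>) (\<alpha> \<star> \<gamma>) \<longleftrightarrow> apart \<beta> \<gamma>"
  unfolding apart_iff_disjoint[where 'g = unit] graft_cat
  by (simp only: image_comp[symmetric] image_Int[OF inj_graft, symmetric] image_is_empty)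

lemma apart_extend:
  assumes "apart \<alpha> \<beta>"
  shows "apart (\<alpha> \<star> \<gamma>) \<beta>" "apart \<alpha> (\<beta> \<star> \<gamma>)"
proof -
  obtain s i where *: "i < length (\<alpha> s)" "i < length (\<beta> s)" "\<alpha> s ! i \<noteq> \<beta> s ! i"
    using assms unfolding apart_def by auto
  then show "apart (\<alpha> \<star> \<gamma>) \<beta>" "apart \<alpha> (\<beta> \<star> \<gamma>)"
    unfolding apart_def by (intro exI[of _ s] exI[of _ i]; simp add: cat_def nth_append)+
qed

lemma apart_word_at:
  "apart (word_at s u) (word_at s v) \<longleftrightarrow> (\<exists>i < min (length u) (length v). u ! i \<noteq> v ! i)"
proof
  assume "apart (word_at s u) (word_at s v)"
  then obtain s' i where "i < min (length (word_at s u s')) (length (word_at s v s'))" "word_at s u s' ! i \<noteq> word_at s v s' ! i"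
    unfolding apart_def by blast
  then show "\<exists>i < min (length u) (length v). u ! i \<noteq> v ! i"
    by (cases "s' = s") (auto simp: word_at_def)
qed (auto simp: apart_def word_at_def)

lemma range_graft_eq_imp:
  assumes "range (graft \<alpha> :: ('s, 'g) point \<Rightarrow> _) = range (graft \<beta>)"
  shows "\<alpha> = \<beta>"
proof
  fix s
  have len: "length (\<alpha> s) \<le> length (\<beta> s)"
    if eq: "range (graft \<alpha> :: ('s, 'g) point \<Rightarrow> _) = range (graft \<beta>)" for \<alpha> \<beta> :: "'s \<Rightarrow> bool list"
  proof (rule ccontr)
    assume "\<not> ?thesis"
    then have l: "length (\<beta> s) < length (\<alpha> s)" by simp
    \<comment> \<open>If \<alpha> were longer at s, a point of the brick of \<beta> could still
      choose its next letter at s freely; it is chosen to contradict \<alpha>.\<close>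
    define z :: "('s, 'g) point" where
      "z = graft \<beta> (\<lambda>t i. \<not> \<alpha> t ! (length (\<beta> s)), undefined)"
    have "z \<in> range (graft \<alpha>)"
      unfolding eq z_def by blast
    then have "fst z s (length (\<beta> s)) = \<alpha> s ! length (\<beta> s)"
      using l unfolding range_graft by blast
    then show False
      by (simp add: z_def graft_def conc_def)
  qed
  have l: "length (\<alpha> s) = length (\<beta> s)"
    using len[OF assms] len[OF assms[symmetric]] by (rule antisym)
  define z :: "('s, 'g) point" where "z = graft \<beta> undefined"
  have "z \<in> range (graft \<alpha>)" "z \<in> range (graft \<beta>)"
    unfolding assms z_def by auto
  then show "\<alpha> s = \<beta> s"
    unfolding range_graft using l by (intro nth_equalityI) metis+
qed

lemma halves_cover: "z \<in> range (graft (word_at s [False])) \<or> z \<in> range (graft (word_at s [True]))"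
  unfolding range_graft by (auto simp: word_at_def)

lemma fun_eq_halves:
  fixes F H :: "('s, 'g) point \<Rightarrow> 'b"
  assumes "\<And>j. F \<circ> graft (word_at s [j]) = H \<circ> graft (word_at s [j])"
  shows "F = H"
proof
  fix z :: "('s, 'g) point"
  obtain j y where "z = graft (word_at s [j]) y"
    using halves_cover[of z s] by blast
  then show "F z = H z"
    using fun_cong[OF assms[of j], of y] by simp
qed

section \<open>Copies of a map in a brick, and transpositions of bricks\<close>

lemma emb_graft [simp]: "emb \<beta> F (graft \<beta> z) = graft \<beta> (F z)"
  by (simp add: emb_def)

lemma emb_outside: "z \<notin> range (graft \<beta>) \<Longrightarrow> emb \<beta> F z = z"
  by (simp add: emb_def)

lemma emb_apart: "apart \<beta> \<gamma> \<Longrightarrow> emb \<beta> F (graft \<gamma> z) = graft \<gamma> z"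
  by (simp add: emb_outside apart_notin apart_sym)

lemma emb_comp: "emb \<beta> (F \<circ> H) = emb \<beta> F \<circ> emb \<beta> H"
  by (auto simp: emb_def fun_eq_iff)

lemma emb_id [simp]: "emb \<beta> id = id"
  by (auto simp: emb_def fun_eq_iff)

lemma emb_cat: "emb (\<alpha> \<star> \<beta>) F = emb \<alpha> (emb \<beta> F)"
proof
  fix z
  show "emb (\<alpha> \<star> \<beta>) F z = emb \<alpha> (emb \<beta> F) z"
  proof (cases "z \<in> range (graft \<alpha>)")
    case True
    then obtain y where z: "z = graft \<alpha> y" by blast
    show ?thesis
    proof (cases "y \<in> range (graft \<beta>)")
      case True
      then obtain x where "y = graft \<beta> x" by blast
      then show ?thesis
        by (simp add: z emb_graft[of "\<alpha> \<star> \<beta>", unfolded graft_cat_apply])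
    next
      case False
      then have "z \<notin> range (graft (\<alpha> \<star> \<beta>))"
        by (auto simp: z graft_cat)
      then show ?thesis
        using False by (simp add: z emb_outside)
    qed
  next
    case False
    then have "z \<notin> range (graft (\<alpha> \<star> \<beta>))"
      by (auto simp: graft_cat)
    then show ?thesis
      using False by (simp add: emb_outside)
  qed
qed

lemma bij_emb: assumes "bij F" shows "bij (emb \<beta> F)"
proof -
  have "emb \<beta> F \<circ> emb \<beta> (invf F) = id" "emb \<beta> (invf F) \<circ> emb \<beta> F = id"
    using assms by (simp_all add: bij_is_inj bij_is_surj surj_iff[THEN iffD1] flip: emb_comp)
  then show ?thesis
    by (rule o_bij[rotated])
qed

lemma emb_commute:
  fixes F H :: "('s, 'g) point \<Rightarrow> ('s, 'g) point"
  assumes a: "apart \<alpha> \<beta>"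
  shows "emb \<alpha> F \<circ> emb \<beta> H = emb \<beta> H \<circ> emb \<alpha> F"
proof
  fix z :: "('s, 'g) point"
  from a have a': "apart \<beta> \<alpha>" by (simp add: apart_sym)
  consider y where "z = graft \<alpha> y" | y where "z = graft \<beta> y" | "z \<notin> range (graft \<alpha>)" "z \<notin> range (graft \<beta>)"
    by blast
  then show "(emb \<alpha> F \<circ> emb \<beta> H) z = (emb \<beta> H \<circ> emb \<alpha> F) z"
    by cases (simp_all add: emb_apart a a' emb_outside)
qed

text \<open>The reason why copies of one element in different bricks are conjugate; the conjugation
  laws of \<open>halved_group\<close> are obtained from it.\<close>

lemma emb_conj:
  assumes "bij U" "U \<circ> graft \<alpha> = graft \<beta>"
  shows "U \<circ> emb \<alpha> F \<circ> invf U = emb \<beta> F"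
proof
  fix z
  obtain y where z: "z = U y"
    using assms(1) by (metis bij_pointE)
  have Ug: "U (graft \<alpha> x) = graft \<beta> x" for x
    using fun_cong[OF assms(2), of x] by simp
  show "(U \<circ> emb \<alpha> F \<circ> invf U) z = emb \<beta> F z"
  proof (cases "y \<in> range (graft \<alpha>)")
    case True
    then show ?thesis
      using assms(1) by (auto simp: z Ug bij_is_inj)
  next
    case False
    then have "z \<notin> range (graft \<beta>)"
      unfolding z using assms(1) by (auto simp: bij_is_inj inj_eq simp flip: Ug)
    then show ?thesis
      using False assms(1) by (simp add: z emb_outside bij_is_inj)
  qed
qed

lemma swp_left [simp]: "swp \<alpha> \<beta> (graft \<alpha> z) = graft \<beta> z"
  by (simp add: swp_def)

lemma swp_same [simp]: "swp \<alpha> \<alpha> = id"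
  by (auto simp: swp_def fun_eq_iff)

lemma swp_right: "apart \<alpha> \<beta> \<Longrightarrow> swp \<alpha> \<beta> (graft \<beta> z) = graft \<alpha> z"
  using apart_notin[of \<beta> \<alpha> z] by (simp add: swp_def apart_sym)

lemma swp_outside: "z \<notin> range (graft \<alpha>) \<Longrightarrow> z \<notin> range (graft \<beta>) \<Longrightarrow> swp \<alpha> \<beta> z = z"
  by (simp add: swp_def)

lemma swp_apart: "apart \<alpha> \<gamma> \<Longrightarrow> apart \<beta> \<gamma> \<Longrightarrow> swp \<alpha> \<beta> (graft \<gamma> z) = graft \<gamma> z"
  by (simp add: swp_outside apart_notin apart_sym)

lemma emb_graft_apart: "apart \<beta> \<gamma> \<Longrightarrow> emb \<beta> F \<circ> graft \<gamma> = graft \<gamma>"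
  by (auto simp: fun_eq_iff emb_apart)

lemma swp_graft_apart: "apart \<alpha> \<gamma> \<Longrightarrow> apart \<beta> \<gamma> \<Longrightarrow> swp \<alpha> \<beta> \<circ> graft \<gamma> = graft \<gamma>"
  by (auto simp: fun_eq_iff swp_apart)

lemma swp_cases [consumes 0, case_names left right outside]:
  obtains y where "z = graft \<alpha> y" | y where "z = graft \<beta> y"
    | "z \<notin> range (graft \<alpha>)" "z \<notin> range (graft \<beta>)"
  by blast

lemma swp_swp: "apart \<alpha> \<beta> \<Longrightarrow> swp \<alpha> \<beta> \<circ> swp \<alpha> \<beta> = id"
proof
  fix z assume "apart \<alpha> \<beta>"
  then show "(swp \<alpha> \<beta> \<circ> swp \<alpha> \<beta>) z = id z"
    by (cases z rule: swp_cases[where \<alpha> = \<alpha> and \<beta> = \<beta>]) (simp_all add: swp_right swp_outside)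
qed

lemma bij_swp: "apart \<alpha> \<beta> \<Longrightarrow> bij (swp \<alpha> \<beta>)"
  by (rule o_bij; erule swp_swp)

lemma inv_swp: "apart \<alpha> \<beta> \<Longrightarrow> invf (swp \<alpha> \<beta>) = swp \<alpha> \<beta>"
  by (rule inv_unique_comp; erule swp_swp)

lemma swp_conj:
  assumes "bij U" "U \<circ> graft \<alpha> = graft \<alpha>'" "U \<circ> graft \<beta> = graft \<beta>'" "apart \<alpha> \<beta>" "apart \<alpha>' \<beta>'"
  shows "U \<circ> swp \<alpha> \<beta> \<circ> invf U = swp \<alpha>' \<beta>'"
proof
  fix z
  obtain y where z: "z = U y"
    using assms(1) by (metis bij_pointE)
  have Ua: "U (graft \<alpha> x) = graft \<alpha>' x" and Ub: "U (graft \<beta> x) = graft \<beta>' x" for x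
    using fun_cong[OF assms(2), of x] fun_cong[OF assms(3), of x] by simp_all
  then have inv_Ua: "invf U (graft \<alpha>' x) = graft \<alpha> x" and inv_Ub: "invf U (graft \<beta>' x) = graft \<beta> x" for x
    using assms(1) by (metis bij_is_inj inv_f_f)+
  show "(U \<circ> swp \<alpha> \<beta> \<circ> invf U) z = swp \<alpha>' \<beta>' z"
  proof (cases y rule: swp_cases[where \<alpha> = \<alpha> and \<beta> = \<beta>])
    case outside
    then have "z \<notin> range (graft \<alpha>')" "z \<notin> range (graft \<beta>')"
      unfolding z using assms(1) by (auto simp: bij_is_inj inj_eq simp flip: Ua Ub)
    then show ?thesis
      using outside assms(1) by (simp add: z swp_outside bij_is_inj)
  qed (use assms(1,4,5) in \<open>simp_all add: z Ua Ub inv_Ua inv_Ub swp_right\<close>)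
qed

lemma rebase_graft: "rebase s s' (graft (word_at s [j]) z) = graft (word_at s' [j]) z"
proof -
  have "fst (graft (word_at s [j]) z) s 0 = j"
    by (simp add: graft_def word_at_def)
  then show ?thesis
    by (simp add: rebase_def)
qed

lemma rebase_rebase: "rebase s' s \<circ> rebase s s' = id"
  by (rule fun_eq_halves[of _ s]) (auto simp: rebase_graft)

lemma bij_rebase: "bij (rebase s s')"
  by (rule o_bij; rule rebase_rebase)

lemma rebase_same [simp]: "rebase s s = id"
  by (rule fun_eq_halves[of _ s]) (auto simp: rebase_graft)

section \<open>The group of labelled homeomorphisms\<close>

text \<open>\<open>s\<^sub>0\<close> is the coordinate in which halves, quarters and combs are
  cut.\<close>

locale twisted_cube = group G for G (structure) +
  fixes S :: "'s set" and act :: "'a \<Rightarrow> 's \<Rightarrow> 's" and s\<^sub>0 :: 's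
  assumes base: "s\<^sub>0 \<in> S"
    and act_closed: "g \<in> carrier G \<Longrightarrow> s \<in> S \<Longrightarrow> act g s \<in> S"
    and act_one: "s \<in> S \<Longrightarrow> act \<one> s = s"
    and act_mult: "g \<in> carrier G \<Longrightarrow> h \<in> carrier G \<Longrightarrow> s \<in> S \<Longrightarrow> act (g \<otimes> h) s = act g (act h s)"
begin

definition move :: "'a \<Rightarrow> 's \<Rightarrow> 's"
  where "move g s = (if s \<in> S then act g s else s)"

definition twist :: "'a \<Rightarrow> ('s, 'a) point \<Rightarrow> ('s, 'a) point"
  where "twist g z = (\<lambda>s. fst z (move (inv g) s), if snd z \<in> carrier G then g \<otimes> snd z else snd z)"

text \<open>The address of the image under g of the brick of \<beta>; see
  \<open>twist_graft\<close>.\<close>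

definition shift :: "'a \<Rightarrow> ('s \<Rightarrow> bool list) \<Rightarrow> 's \<Rightarrow> bool list"
  where "shift g \<beta> = (\<lambda>s. \<beta> (move (inv g) s))"

text \<open>In contrast to \<open>address\<close>, the words outside S are required to be empty:
  grafting then leaves those coordinates alone, and a brick has only one address.\<close>

definition addresses :: "('s \<Rightarrow> bool list) set"
  where "addresses = {\<beta>. finite {s. \<beta> s \<noteq> []} \<and> {s. \<beta> s \<noteq> []} \<subseteq> S}"

definition canonical :: "(('s, 'a) point \<Rightarrow> ('s, 'a) point) \<Rightarrow> ('s \<Rightarrow> bool list) \<Rightarrow> bool"
  where "canonical F \<alpha> \<longleftrightarrow> (\<exists>\<beta>\<in>addresses. \<exists>g\<in>carrier G. F \<circ> graft \<alpha> = graft \<beta> \<circ> twist g)"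

text \<open>A table is demanded only locally, around each point, which makes closure under
  composition and inverse a local matter. Compactness supplies finite tables in
  \<open>canonical_table\<close>.\<close>

definition V :: "(('s, 'a) point \<Rightarrow> ('s, 'a) point) set"
  where "V = {F. bij F \<and> (\<forall>z :: ('s, 'a) point. \<exists>\<alpha>\<in>addresses. z \<in> range (graft \<alpha>) \<and> canonical F \<alpha>)}"

definition V_group :: "(('s, 'a) point \<Rightarrow> ('s, 'a) point) monoid"
  where "V_group = \<lparr>carrier = V, monoid.mult = (\<circ>), one = id\<rparr>"

lemma move_one [simp]: "move \<one> s = s"
  by (simp add: move_def act_one)

lemma move_mult: "g \<in> carrier G \<Longrightarrow> h \<in> carrier G \<Longrightarrow> move (g \<otimes> h) s = move g (move h s)"
  by (auto simp: move_def act_mult act_closed)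

lemma move_in_iff [simp]: "g \<in> carrier G \<Longrightarrow> move g s \<in> S \<longleftrightarrow> s \<in> S"
  by (auto simp: move_def act_closed)

lemma move_inv [simp]:
  "g \<in> carrier G \<Longrightarrow> move (inv g) (move g s) = s"
  "g \<in> carrier G \<Longrightarrow> move g (move (inv g) s) = s"
  by (simp_all flip: move_mult)

lemma twist_mult:
  "g \<in> carrier G \<Longrightarrow> h \<in> carrier G \<Longrightarrow> twist (g \<otimes> h) = twist g \<circ> twist h"
  by (auto simp: twist_def fun_eq_iff inv_mult_group move_mult m_assoc)

lemma twist_one [simp]: "twist \<one> = id"
  by (auto simp: twist_def fun_eq_iff)

lemma twist_inv [simp]:
  "g \<in> carrier G \<Longrightarrow> twist (inv g) \<circ> twist g = id"
  "g \<in> carrier G \<Longrightarrow> twist g \<circ> twist (inv g) = id"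
  by (simp_all flip: twist_mult)

lemma twist_inv_apply [simp]:
  "g \<in> carrier G \<Longrightarrow> twist (inv g) (twist g z) = z"
  "g \<in> carrier G \<Longrightarrow> twist g (twist (inv g) z) = z"
  by (metis comp_apply id_apply twist_inv)+

lemma bij_twist: "g \<in> carrier G \<Longrightarrow> bij (twist g)"
  by (rule o_bij[of "twist (inv g)"]) simp_all

lemma twist_graft: "twist g \<circ> graft \<beta> = graft (shift g \<beta>) \<circ> twist g"
  by (auto simp: twist_def graft_def shift_def)

lemma twist_graft_apply: "twist g (graft \<beta> z) = graft (shift g \<beta>) (twist g z)"
  using fun_cong[OF twist_graft, of g \<beta> z] by simp

lemma shift_inv [simp]:
  "g \<in> carrier G \<Longrightarrow> shift (inv g) (shift g \<beta>) = \<beta>"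
  "g \<in> carrier G \<Longrightarrow> shift g (shift (inv g) \<beta>) = \<beta>"
  by (auto simp: shift_def)

lemma shift_word_at: "g \<in> carrier G \<Longrightarrow> shift g (word_at s w) = word_at (move g s) w"
  by (auto simp: shift_def word_at_def fun_eq_iff)

lemma addresses_triv [simp]: "triv \<in> addresses"
  by (simp add: addresses_def)

lemma addresses_word_at [simp]: "s \<in> S \<Longrightarrow> word_at s w \<in> addresses"
  using finite_subset[of "{t. word_at s w t \<noteq> []}" "{s}"]
  by (auto simp: addresses_def word_at_def split: if_splits)

lemma addresses_cat [simp]:
  assumes "\<alpha> \<in> addresses" "\<beta> \<in> addresses" shows "\<alpha> \<star> \<beta> \<in> addresses"
proof -
  have "{s. (\<alpha> \<star> \<beta>) s \<noteq> []} = {s. \<alpha> s \<noteq> []} \<union> {s. \<beta> s \<noteq> []}"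
    by (auto simp: cat_def)
  then show ?thesis
    using assms by (auto simp: addresses_def)
qed

lemma addresses_shift [simp]:
  assumes "\<alpha> \<in> addresses" "g \<in> carrier G" shows "shift g \<alpha> \<in> addresses"
proof -
  have "{s. shift g \<alpha> s \<noteq> []} = move g ` {s. \<alpha> s \<noteq> []}"
    using assms(2) by (force simp: shift_def)
  then show ?thesis
    using assms by (auto simp: addresses_def)
qed

lemma canonicalI: "\<beta> \<in> addresses \<Longrightarrow> g \<in> carrier G \<Longrightarrow> F \<circ> graft \<alpha> = graft \<beta> \<circ> twist g \<Longrightarrow> canonical F \<alpha>"
  unfolding canonical_def by blast

lemma canonicalI_one: "\<beta> \<in> addresses \<Longrightarrow> F \<circ> graft \<alpha> = graft \<beta> \<Longrightarrow> canonical F \<alpha>"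
  by (rule canonicalI[of _ \<one>]) simp_all

text \<open>Refinement of a table entry. Since g moves coordinates, the extension reappears as
  \<open>shift g \<chi>\<close>; for a single letter this is the relation between g and the simple
  splits.\<close>

lemma canonical_extend:
  assumes "F \<circ> graft \<alpha> = graft \<beta> \<circ> twist g"
  shows "F \<circ> graft (\<alpha> \<star> \<chi>) = graft (\<beta> \<star> shift g \<chi>) \<circ> twist g"
proof -
  have "F \<circ> graft (\<alpha> \<star> \<chi>) = graft \<beta> \<circ> (twist g \<circ> graft \<chi>)"
    by (simp only: graft_cat assms flip: o_assoc[symmetric])
  then show ?thesis
    by (simp only: twist_graft graft_cat o_assoc)
qed

lemma canonical_cat:
  assumes "canonical F \<alpha>" "\<chi> \<in> addresses" shows "canonical F (\<alpha> \<star> \<chi>)"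
proof -
  obtain \<beta> g where "\<beta> \<in> addresses" "g \<in> carrier G" "F \<circ> graft \<alpha> = graft \<beta> \<circ> twist g"
    using assms(1) unfolding canonical_def by blast
  then show ?thesis
    using assms(2) by (intro canonicalI[of "\<beta> \<star> shift g \<chi>" g] canonical_extend) simp_all
qed

lemma common_extension:
  assumes "\<alpha> \<in> addresses" "\<beta> \<in> addresses" "z \<in> range (graft \<alpha>)" "z \<in> range (graft \<beta>)"
  obtains \<gamma> \<delta> where "\<gamma> \<in> addresses" "\<delta> \<in> addresses" "\<alpha> \<star> \<gamma> = \<beta> \<star> \<delta>" "z \<in> range (graft (\<alpha> \<star> \<gamma>))"
proof
  \<comment> \<open>The letters of the second address beyond the length of the first. Both addresses
    are read off the same point, so they agree as far as both reach.\<close>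
  define ext where "ext \<alpha> \<beta> s = drop (length (\<alpha> s)) (\<beta> s)" for \<alpha> \<beta> :: "'s \<Rightarrow> bool list" and s
  have ext: "ext \<alpha> \<beta> \<in> addresses" if "\<beta> \<in> addresses" for \<alpha> \<beta>
  proof -
    have "{s. ext \<alpha> \<beta> s \<noteq> []} \<subseteq> {s. \<beta> s \<noteq> []}"
      by (auto simp: ext_def)
    then show ?thesis
      using that unfolding addresses_def by (blast intro: finite_subset)
  qed
  show "ext \<alpha> \<beta> \<in> addresses" "ext \<beta> \<alpha> \<in> addresses"
    using ext assms by auto
  have eq: "\<alpha> s ! i = \<beta> s ! i" if "i < length (\<alpha> s)" "i < length (\<beta> s)" for s i
    using assms(3,4) that unfolding range_graft by metis
  show "\<alpha> \<star> ext \<alpha> \<beta> = \<beta> \<star> ext \<beta> \<alpha>"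
  proof
    fix s
    show "(\<alpha> \<star> ext \<alpha> \<beta>) s = (\<beta> \<star> ext \<beta> \<alpha>) s"
      by (rule nth_equalityI) (auto simp: cat_def ext_def nth_append eq)
  qed
  show "z \<in> range (graft (\<alpha> \<star> ext \<alpha> \<beta>))"
    using assms(3,4) unfolding range_graft by (auto simp: cat_def ext_def nth_append)
qed

lemma separate:
  assumes "\<beta> \<in> addresses" "z \<notin> range (graft \<beta>)"
  obtains \<gamma> where "\<gamma> \<in> addresses" "z \<in> range (graft \<gamma>)" "apart \<gamma> \<beta>"
proof
  \<comment> \<open>\<gamma> reads z exactly as deep as \<beta> does in each coordinate, so the
    letter that keeps z out of the brick of \<beta> is visible in \<gamma>.\<close>
  define \<gamma> where "\<gamma> s = map (fst z s) [0..<length (\<beta> s)]" for s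
  show "\<gamma> \<in> addresses"
    using assms(1) by (simp add: addresses_def \<gamma>_def)
  show "z \<in> range (graft \<gamma>)"
    by (simp add: range_graft \<gamma>_def)
  show "apart \<gamma> \<beta>"
    using assms(2) unfolding range_graft apart_def by (force simp: \<gamma>_def)
qed

lemma V_bij: "F \<in> V \<Longrightarrow> bij F"
  by (simp add: V_def)

text \<open>A local table entry can be taken inside any prescribed brick around the point and any
  prescribed brick around its image. First the source is refined to lie in \<alpha>, then the
  refinement required at the target is pulled back through g.\<close>

lemma V_local:
  assumes "F \<in> V" and \<alpha>: "\<alpha> \<in> addresses" "z \<in> range (graft \<alpha>)"
    and \<beta>: "\<beta> \<in> addresses" "F z \<in> range (graft \<beta>)"
  obtains \<chi> \<phi> g where "\<chi> \<in> addresses" "z \<in> range (graft (\<alpha> \<star> \<chi>))"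
    "\<phi> \<in> addresses" "g \<in> carrier G" "F \<circ> graft (\<alpha> \<star> \<chi>) = graft (\<beta> \<star> \<phi>) \<circ> twist g"
proof -
  obtain \<alpha>\<^sub>1 \<beta>\<^sub>1 g where 1: "\<alpha>\<^sub>1 \<in> addresses" "z \<in> range (graft \<alpha>\<^sub>1)" "\<beta>\<^sub>1 \<in> addresses" and g: "g \<in> carrier G"
    and F1: "F \<circ> graft \<alpha>\<^sub>1 = graft \<beta>\<^sub>1 \<circ> twist g"
    using assms(1) unfolding V_def canonical_def by blast
  obtain \<gamma> \<delta> where \<gamma>\<delta>: "\<gamma> \<in> addresses" "\<delta> \<in> addresses" "\<alpha>\<^sub>1 \<star> \<gamma> = \<alpha> \<star> \<delta>" "z \<in> range (graft (\<alpha>\<^sub>1 \<star> \<gamma>))"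
    using common_extension[OF 1(1) \<alpha>(1) 1(2) \<alpha>(2)] .
  define \<beta>\<^sub>2 where "\<beta>\<^sub>2 = \<beta>\<^sub>1 \<star> shift g \<gamma>"
  have F2: "F \<circ> graft (\<alpha> \<star> \<delta>) = graft \<beta>\<^sub>2 \<circ> twist g"
    using canonical_extend[OF F1, of \<gamma>] by (simp add: \<gamma>\<delta>(3) \<beta>\<^sub>2_def)
  obtain y where y: "z = graft (\<alpha> \<star> \<delta>) y"
    using \<gamma>\<delta>(3,4) by auto
  have Fz: "F z = graft \<beta>\<^sub>2 (twist g y)"
    using fun_cong[OF F2, of y] y by simp
  then have "F z \<in> range (graft \<beta>\<^sub>2)" by blast
  moreover have "\<beta>\<^sub>2 \<in> addresses"
    using 1(3) \<gamma>\<delta>(1) g by (simp add: \<beta>\<^sub>2_def)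
  ultimately obtain \<epsilon> \<eta> where \<epsilon>\<eta>: "\<epsilon> \<in> addresses" "\<eta> \<in> addresses" "\<beta>\<^sub>2 \<star> \<epsilon> = \<beta> \<star> \<eta>" "F z \<in> range (graft (\<beta>\<^sub>2 \<star> \<epsilon>))"
    using common_extension \<beta> by metis
  then obtain x where "F z = graft \<beta>\<^sub>2 (graft \<epsilon> x)"
    unfolding graft_cat comp_def by blast
  then have "twist g y = graft \<epsilon> x"
    using Fz by simp
  \<comment> \<open>The target extension \<epsilon> is produced by the source extension
    \<open>shift (inv g) \<epsilon>\<close>.\<close>
  then have "y = graft (shift (inv g) \<epsilon>) (twist (inv g) x)"
    using g by (metis twist_graft_apply twist_inv_apply(1))
  then have "z \<in> range (graft (\<alpha> \<star> (\<delta> \<star> shift (inv g) \<epsilon>)))"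
    by (simp add: y graft_cat)
  moreover have "F \<circ> graft (\<alpha> \<star> (\<delta> \<star> shift (inv g) \<epsilon>)) = graft (\<beta> \<star> \<eta>) \<circ> twist g"
    using canonical_extend[OF F2, of "shift (inv g) \<epsilon>"] g by (simp add: cat_assoc \<epsilon>\<eta>(3))
  moreover have "\<delta> \<star> shift (inv g) \<epsilon> \<in> addresses"
    using \<gamma>\<delta> \<epsilon>\<eta> g by simp
  ultimately show ?thesis
    using that \<epsilon>\<eta>(2) g by blast
qed

lemma V_I:
  assumes "bij F" "\<And>z :: ('s, 'a) point. \<exists>\<alpha>\<in>addresses. z \<in> range (graft \<alpha>) \<and> canonical F \<alpha>" shows "F \<in> V"
  using assms by (simp add: V_def)

lemma V_id [simp]: "id \<in> V"
  by (rule V_I) (auto intro!: bexI[of _ triv] canonicalI_one[of triv])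

lemma V_comp [simp]:
  assumes F: "F \<in> V" and H: "H \<in> V" shows "F \<circ> H \<in> V"
proof (rule V_I)
  show "bij (F \<circ> H)"
    using assms by (intro bij_comp V_bij)
  fix z
  obtain \<chi> \<phi> g where \<chi>: "\<chi> \<in> addresses" "H z \<in> range (graft \<chi>)"
    "\<phi> \<in> addresses" "g \<in> carrier G" "F \<circ> graft \<chi> = graft \<phi> \<circ> twist g"
    by (rule V_local[OF F, of triv "H z" triv]) auto
  \<comment> \<open>The entry of \<open>H\<close> is chosen after that of \<open>F\<close>, with its
    image inside the source brick \<chi> of \<open>F\<close>, so that the two compose.\<close>
  obtain \<alpha> \<psi> h where \<alpha>: "\<alpha> \<in> addresses" "z \<in> range (graft \<alpha>)"
    "\<psi> \<in> addresses" "h \<in> carrier G" "H \<circ> graft \<alpha> = graft (\<chi> \<star> \<psi>) \<circ> twist h"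
    by (rule V_local[OF H, of triv z \<chi>]) (use \<chi> in auto)
  have "(F \<circ> H) \<circ> graft \<alpha> = F \<circ> graft (\<chi> \<star> \<psi>) \<circ> twist h"
    by (simp only: \<alpha>(5) o_assoc[symmetric])
  also have "\<dots> = graft (\<phi> \<star> shift g \<psi>) \<circ> twist (g \<otimes> h)"
    unfolding canonical_extend[OF \<chi>(5)] using \<chi> \<alpha> by (simp add: twist_mult o_assoc)
  finally have "canonical (F \<circ> H) \<alpha>"
    using \<chi> \<alpha> by (intro canonicalI[of "\<phi> \<star> shift g \<psi>" "g \<otimes> h"]) simp_all
  then show "\<exists>\<alpha>\<in>addresses. z \<in> range (graft \<alpha>) \<and> canonical (F \<circ> H) \<alpha>"
    using \<alpha> by blast
qed

lemma V_inv [simp]: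
  assumes F: "F \<in> V" shows "invf F \<in> V"
proof (rule V_I)
  note bij = V_bij[OF F]
  then show "bij (invf F)"
    by (rule bij_imp_bij_inv)
  fix z
  define y where "y = invf F z"
  obtain \<alpha> \<beta> g where *: "\<alpha> \<in> addresses" "y \<in> range (graft \<alpha>)" "\<beta> \<in> addresses" "g \<in> carrier G"
    "F \<circ> graft \<alpha> = graft \<beta> \<circ> twist g"
    using F unfolding V_def canonical_def by blast
  have "z = F y"
    using bij by (simp add: y_def bij_is_surj surj_f_inv_f)
  then have "z \<in> range (graft \<beta>)"
    using *(2) fun_cong[OF *(5)] by auto
  moreover have "invf F \<circ> graft \<beta> = graft \<alpha> \<circ> twist (inv g)"
  proof
    fix x
    have "graft \<beta> x = F (graft \<alpha> (twist (inv g) x))"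
      using fun_cong[OF *(5), of "twist (inv g) x"] *(4) by simp
    then show "(invf F \<circ> graft \<beta>) x = (graft \<alpha> \<circ> twist (inv g)) x"
      using bij by (simp add: bij_is_inj)
  qed
  ultimately show "\<exists>\<alpha>\<in>addresses. z \<in> range (graft \<alpha>) \<and> canonical (invf F) \<alpha>"
    using * by (intro bexI[of _ \<beta>] conjI canonicalI[of \<alpha> "inv g"]) simp_all
qed

lemma V_group_simps [simp]:
  "carrier V_group = V" "F \<otimes>\<^bsub>V_group\<^esub> H = F \<circ> H" "\<one>\<^bsub>V_group\<^esub> = id"
  by (simp_all add: V_group_def)

lemma inv_comp [simp]:
  "F \<in> V \<Longrightarrow> invf F \<circ> F = id" "F \<in> V \<Longrightarrow> F \<circ> invf F = id"
  by (simp_all add: V_bij bij_is_inj bij_is_surj flip: surj_iff)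

lemma V_invf_apply [simp]:
  "F \<in> V \<Longrightarrow> invf F (F z) = z" "F \<in> V \<Longrightarrow> F (invf F z) = z"
  by (simp_all add: V_bij bij_is_inj bij_is_surj surj_f_inv_f)

sublocale V: group V_group
proof (rule groupI)
  fix F assume "F \<in> carrier V_group"
  then show "\<exists>H\<in>carrier V_group. H \<otimes>\<^bsub>V_group\<^esub> F = \<one>\<^bsub>V_group\<^esub>"
    by (intro bexI[of _ "invf F"]) simp_all
qed (auto simp: o_assoc)

lemma V_group_inv [simp]: "F \<in> V \<Longrightarrow> inv\<^bsub>V_group\<^esub> F = invf F"
  by (rule V.inv_equality) simp_all

lemma twist_in_V [simp]: "g \<in> carrier G \<Longrightarrow> twist g \<in> V"
  by (rule V_I) (auto simp: bij_twist intro!: bexI[of _ triv] canonicalI[of triv g])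

lemma emb_in_V [simp]:
  assumes F: "F \<in> V" and \<beta>: "\<beta> \<in> addresses" shows "emb \<beta> F \<in> V"
proof (rule V_I)
  show "bij (emb \<beta> F)"
    using F by (intro bij_emb V_bij)
  fix z :: "('s, 'a) point"
  show "\<exists>\<alpha>\<in>addresses. z \<in> range (graft \<alpha>) \<and> canonical (emb \<beta> F) \<alpha>"
  proof (cases "z \<in> range (graft \<beta>)")
    case True
    then obtain y where z: "z = graft \<beta> y" by blast
    obtain \<alpha> \<phi> g where *: "\<alpha> \<in> addresses" "y \<in> range (graft \<alpha>)" "\<phi> \<in> addresses" "g \<in> carrier G"
      "F \<circ> graft \<alpha> = graft \<phi> \<circ> twist g"
      by (rule V_local[OF F, of triv y triv]) auto
    have "emb \<beta> F \<circ> graft (\<beta> \<star> \<alpha>) = graft (\<beta> \<star> \<phi>) \<circ> twist g"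
      using fun_cong[OF *(5)] by (auto simp: graft_cat fun_eq_iff)
    then show ?thesis
      using * \<beta> z by (intro bexI[of _ "\<beta> \<star> \<alpha>"] conjI canonicalI[of "\<beta> \<star> \<phi>" g]) (auto simp: graft_cat)
  next
    case False
    then obtain \<gamma> where \<gamma>: "\<gamma> \<in> addresses" "z \<in> range (graft \<gamma>)" "apart \<gamma> \<beta>"
      using separate[OF \<beta>] by blast
    then have "emb \<beta> F \<circ> graft \<gamma> = graft \<gamma>"
      by (auto simp: fun_eq_iff emb_apart apart_sym)
    then show ?thesis
      using \<gamma> by (intro bexI[of _ \<gamma>] conjI canonicalI_one[of \<gamma>])
  qed
qed

lemma swp_in_V [simp]:
  assumes \<alpha>: "\<alpha> \<in> addresses" and \<beta>: "\<beta> \<in> addresses" and apart: "apart \<alpha> \<beta>"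
  shows "swp \<alpha> \<beta> \<in> V"
proof (rule V_I)
  show "bij (swp \<alpha> \<beta>)"
    using apart by (rule bij_swp)
  fix z :: "('s, 'a) point"
  show "\<exists>\<gamma>\<in>addresses. z \<in> range (graft \<gamma>) \<and> canonical (swp \<alpha> \<beta>) \<gamma>"
  proof (cases z rule: swp_cases[where \<alpha> = \<alpha> and \<beta> = \<beta>])
    case outside
    \<comment> \<open>One brick around z misses \<alpha>, another misses \<beta>; their intersection
      misses both and is fixed by the transposition.\<close>
    obtain \<gamma> where \<gamma>: "\<gamma> \<in> addresses" "z \<in> range (graft \<gamma>)" "apart \<gamma> \<alpha>"
      using separate[OF \<alpha> outside(1)] .
    obtain \<delta> where \<delta>: "\<delta> \<in> addresses" "z \<in> range (graft \<delta>)" "apart \<delta> \<beta>"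
      using separate[OF \<beta> outside(2)] .
    obtain \<gamma>' \<delta>' where *: "\<gamma>' \<in> addresses" "\<delta>' \<in> addresses" "\<gamma> \<star> \<gamma>' = \<delta> \<star> \<delta>'" "z \<in> range (graft (\<gamma> \<star> \<gamma>'))"
      using common_extension[OF \<gamma>(1) \<delta>(1) \<gamma>(2) \<delta>(2)] .
    have "apart \<alpha> (\<gamma> \<star> \<gamma>')" "apart \<beta> (\<gamma> \<star> \<gamma>')"
      using \<gamma>(3) \<delta>(3) apart_extend *(3) by (metis apart_sym)+
    then have "swp \<alpha> \<beta> \<circ> graft (\<gamma> \<star> \<gamma>') = graft (\<gamma> \<star> \<gamma>')"
      by (auto simp: fun_eq_iff swp_apart)
    then show ?thesis
      using *(4) addresses_cat[OF \<gamma>(1) *(1)]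
      by (intro bexI[of _ "\<gamma> \<star> \<gamma>'"] conjI canonicalI_one[of "\<gamma> \<star> \<gamma>'"])
  next
    case left
    then show ?thesis
      using \<alpha> \<beta> by (intro bexI[of _ \<alpha>] conjI canonicalI_one[of \<beta>]) (auto simp: fun_eq_iff)
  next
    case right
    then show ?thesis
      using \<alpha> \<beta> apart by (intro bexI[of _ \<beta>] conjI canonicalI_one[of \<alpha>]) (auto simp: fun_eq_iff swp_right)
  qed
qed

lemma rebase_in_V [simp]:
  assumes "s \<in> S" "s' \<in> S" shows "rebase s s' \<in> V"
proof (rule V_I)
  show "bij (rebase s s' :: ('s, 'a) point \<Rightarrow> _)"
    by (rule bij_rebase)
  fix z :: "('s, 'a) point"
  obtain j where "z \<in> range (graft (word_at s [j]))"
    using halves_cover[of z s] by blast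
  then show "\<exists>\<gamma>\<in>addresses. z \<in> range (graft \<gamma>) \<and> canonical (rebase s s') \<gamma>"
    using assms by (intro bexI[of _ "word_at s [j]"] conjI canonicalI_one[of "word_at s' [j]"])
      (auto simp: fun_eq_iff rebase_graft)
qed

end

section \<open>Elements of the commutator subgroup\<close>

context twisted_cube
begin

abbreviation half :: "bool \<Rightarrow> 's \<Rightarrow> bool list"
  where "half j \<equiv> word_at s\<^sub>0 [j]"

abbreviation D :: "(('s, 'a) point \<Rightarrow> ('s, 'a) point) set"
  where "D \<equiv> derived V_group V"

lemma half_address [simp]: "half j \<in> addresses"
  using base by simp

lemma apart_half: "i \<noteq> j \<Longrightarrow> apart (half i) (half j)"
  by (auto simp: apart_word_at)

text \<open>\<open>P\<close> exchanges the first halves of the two bricks, and \<open>W\<close>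
  exchanges the two halves inside each brick. So the conjugate of \<open>P\<close> by
  \<open>W\<close> exchanges the second halves, and since \<open>P\<close> is an involution the full
  transposition is the commutator of \<open>P\<close> and \<open>W\<close>.\<close>

lemma swp_commutator:
  assumes \<alpha>: "\<alpha> \<in> addresses" and \<beta>: "\<beta> \<in> addresses" and apart: "apart \<alpha> \<beta>"
  shows "swp \<alpha> \<beta> \<in> derived_set V_group (carrier V_group)"
proof -
  let ?a = "\<lambda>j. \<alpha> \<star> half j" and ?b = "\<lambda>j. \<beta> \<star> half j"
  have ab: "apart (?a i) (?b j)" "apart (?b i) (?a j)" for i j
    using apart apart_extend by (metis apart_sym)+
  have aa: "apart (?a True) (?a False)" "apart (?a False) (?a True)" "apart (?b True) (?b False)"
      "apart (?b False) (?b True)"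
    by (simp_all add: apart_half)
  define P where "P = (swp (?a False) (?b False) :: ('s, 'a) point \<Rightarrow> _)"
  define W where "W = (swp (?a False) (?a True) \<circ> swp (?b False) (?b True) :: ('s, 'a) point \<Rightarrow> _)"
  have P: "P \<in> V" and W: "W \<in> V"
    using \<alpha> \<beta> aa ab unfolding P_def W_def by simp_all
  have "W \<circ> graft (?a False) = graft (?a True)"
    using ab by (simp add: W_def fun_eq_iff swp_apart)
  moreover have "W \<circ> graft (?b False) = graft (?b True)"
    using ab by (simp add: W_def fun_eq_iff swp_apart)
  ultimately have WP: "W \<circ> P \<circ> invf W = swp (?a True) (?b True)"
    unfolding P_def using ab W by (intro swp_conj V_bij)
  have "P \<circ> swp (?a True) (?b True) = swp \<alpha> \<beta>"
  proof
    fix z :: "('s, 'a) point"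
    show "(P \<circ> swp (?a True) (?b True)) z = swp \<alpha> \<beta> z"
    proof (cases z rule: swp_cases[where \<alpha> = \<alpha> and \<beta> = \<beta>])
      case (left y)
      obtain j x where y: "y = graft (half j) x"
        using halves_cover[of y s\<^sub>0] by blast
      have z: "z = graft (?a j) x"
        by (simp add: left y graft_cat)
      have "swp \<alpha> \<beta> z = graft (?b j) x"
        by (simp add: left y graft_cat)
      then show ?thesis
        using ab aa unfolding z P_def by (cases j) (simp_all add: swp_apart)
    next
      case (right y)
      obtain j x where y: "y = graft (half j) x"
        using halves_cover[of y s\<^sub>0] by blast
      have z: "z = graft (?b j) x"
        by (simp add: right y graft_cat)
      have "swp \<alpha> \<beta> z = graft (?a j) x"
        by (simp add: right y graft_cat swp_right apart)
      then show ?thesis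
        using ab aa unfolding z P_def by (cases j) (simp_all add: swp_apart swp_right)
    next
      case outside
      then have "z \<notin> range (graft (?a j))" "z \<notin> range (graft (?b j))" for j
        by (auto simp: graft_cat)
      then show ?thesis
        using outside by (simp add: P_def swp_outside)
    qed
  qed
  moreover have "invf P = P"
    unfolding P_def using ab by (intro inv_swp)
  ultimately have "swp \<alpha> \<beta> = P \<otimes>\<^bsub>V_group\<^esub> W \<otimes>\<^bsub>V_group\<^esub> inv\<^bsub>V_group\<^esub> P \<otimes>\<^bsub>V_group\<^esub> inv\<^bsub>V_group\<^esub> W"
    using P W by (simp add: o_assoc[symmetric] flip: WP)
  then show ?thesis
    using P W by (intro V.derived_setI[of P W]) simp_all
qed

lemma D_in_V: "F \<in> D \<Longrightarrow> F \<in> V"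
  using V.derived_closed by simp

lemma D_comp: "F \<in> D \<Longrightarrow> H \<in> D \<Longrightarrow> F \<circ> H \<in> D"
  using V.derived_mult[of F H] by simp

lemma D_inv: "F \<in> D \<Longrightarrow> invf F \<in> D"
  using V.derived_inv[of F] D_in_V by simp

lemma D_id: "id \<in> D"
  using V.derived_one by simp

lemma D_cancel_left: "F \<in> D \<Longrightarrow> H \<in> V \<Longrightarrow> F \<circ> H \<in> D \<Longrightarrow> H \<in> D"
  using D_comp[OF D_inv, of F "F \<circ> H"] D_in_V[of F] by (simp add: o_assoc)

lemma swp_in_D:
  assumes "\<alpha> \<in> addresses" "\<beta> \<in> addresses" "\<alpha> = \<beta> \<or> apart \<alpha> \<beta>"
  shows "swp \<alpha> \<beta> \<in> D"
  using assms(3)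
proof
  assume "apart \<alpha> \<beta>"
  from V.derived_set_in_derived[OF swp_commutator[OF assms(1,2) this]] show ?thesis
    by simp
qed (simp add: D_id)

lemma emb_hom: "\<beta> \<in> addresses \<Longrightarrow> emb \<beta> \<in> hom V_group V_group"
  by (rule homI) (simp_all add: emb_comp)

lemma emb_in_D: "\<beta> \<in> addresses \<Longrightarrow> F \<in> D \<Longrightarrow> emb \<beta> F \<in> D"
  using V.hom_derived[OF emb_hom] by simp

text \<open>The half 0 is sent to a quarter of itself by way of the half 1, because each
  transposition must exchange disjoint bricks.\<close>

definition squeeze :: "bool \<Rightarrow> ('s, 'a) point \<Rightarrow> ('s, 'a) point"
  where "squeeze j = swp (half True) (half False \<star> half j) \<circ> swp (half False) (half True)"

lemma squeeze_in_V: "squeeze j \<in> V"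
  unfolding squeeze_def
  by (intro V_comp swp_in_V apart_extend(2) addresses_cat) (simp_all add: apart_half)

lemma squeeze_graft: "squeeze j \<circ> graft (half False) = graft (half False \<star> half j)"
  by (simp add: squeeze_def fun_eq_iff)

lemma squeeze_conj: "squeeze j \<circ> emb (half False) F \<circ> invf (squeeze j) = emb (half False) (emb (half j) F)"
  using emb_conj[OF V_bij[OF squeeze_in_V] squeeze_graft] by (simp only: emb_cat)

text \<open>\<open>squeeze False\<close> shrinks the half 0 to the quarter 00 and serves as
  \<open>t\<close>; \<open>squeeze True\<close> shrinks it to 01 and serves as \<open>u\<close>; the
  exchange of the halves serves as \<open>w\<close>.\<close>

sublocale halves: halved_group V_group "emb (half False)" "emb (half True)"
  "squeeze False" "squeeze True" "swp (half False) (half True)"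
proof unfold_locales
  fix F :: "('s, 'a) point \<Rightarrow> ('s, 'a) point"
  have swp: "swp (half False) (half True) \<in> V"
    by (simp add: apart_half)
  then show "swp (half False) (half True) \<in> carrier V_group"
    by simp
  show "swp (half False) (half True) \<otimes>\<^bsub>V_group\<^esub> emb (half False) F \<otimes>\<^bsub>V_group\<^esub>
      inv\<^bsub>V_group\<^esub> (swp (half False) (half True)) = emb (half True) F"
    using emb_conj[OF V_bij[OF swp], of "half False" "half True" F] swp by (simp add: fun_eq_iff)
qed (simp_all add: emb_hom squeeze_in_V squeeze_conj emb_commute apart_half)

text \<open>Let a point begin with i at \<open>s\<^sub>0\<close> and with j at s. Rebasing on the
  whole cube puts j before i, rebasing inside the halves puts j after i. The two results differ by
  the exchange \<rho> of the quarters 01 and 10, so \<open>derived_if_doubled\<close>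
  applies.\<close>

lemma rebase_in_D:
  assumes s: "s \<in> S" shows "rebase s s\<^sub>0 \<in> D"
proof (cases "s = s\<^sub>0")
  case False
  let ?b = "rebase s s\<^sub>0 :: ('s, 'a) point \<Rightarrow> _"
  let ?q = "\<lambda>i j. word_at s\<^sub>0 [i, j]"
  define \<rho> where "\<rho> = (swp (?q False True) (?q True False) :: ('s, 'a) point \<Rightarrow> _)"
  have apart: "apart (?q i j) (?q i' j')" if "(i, j) \<noteq> (i', j')" for i j i' j'
    using that by (auto simp: apart_word_at less_Suc_eq numeral_2_eq_2)
  have q: "graft (half i) (graft (half j) y) = graft (?q i j) y" for i j and y :: "('s, 'a) point"
    by (simp flip: graft_cat_apply)
  have commute: "graft (half i) (graft (word_at s [j]) y) = graft (word_at s [j]) (graft (half i) y)"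
    for i j and y :: "('s, 'a) point"
    using word_at_cat_commute[OF False] by (simp flip: graft_cat_apply)
  have "\<rho> \<in> D"
    unfolding \<rho>_def using base by (intro swp_in_D) (simp_all add: apart)
  moreover have "?b = \<rho> \<circ> emb (half False) ?b \<circ> emb (half True) ?b"
  proof
    fix z :: "('s, 'a) point"
    obtain i x where "z = graft (half i) x"
      using halves_cover[of z s\<^sub>0] by blast
    moreover obtain j y where "x = graft (word_at s [j]) y"
      using halves_cover[of x s] by blast
    ultimately have z: "z = graft (half i) (graft (word_at s [j]) y)"
      by simp
    have "?b z = graft (?q j i) y"
      unfolding z commute by (simp add: rebase_graft q)
    moreover have "(emb (half False) ?b \<circ> emb (half True) ?b) z = graft (?q i j) y"
      unfolding z by (cases i) (simp_all add: rebase_graft q emb_apart apart_half flip: q)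
    moreover have "\<rho> (graft (?q i j) y) = graft (?q j i) y"
      unfolding \<rho>_def by (cases i; cases j) (simp_all add: swp_right swp_apart apart)
    ultimately show "?b z = (\<rho> \<circ> emb (half False) ?b \<circ> emb (half True) ?b) z"
      by simp
  qed
  ultimately show ?thesis
    using halves.derived_if_doubled[of ?b \<rho>] s base by simp
qed (simp add: D_id)

text \<open>The relation of g with the simple split at \<open>s\<^sub>0\<close> makes g equal to its
  two copies in the halves, up to a change of split coordinate, which is in \<open>D\<close> by
  \<open>rebase_in_D\<close>.\<close>

lemma twist_in_D:
  assumes g: "g \<in> carrier G" shows "twist g \<in> D"
proof -
  let ?r = "rebase s\<^sub>0 (move g s\<^sub>0) :: ('s, 'a) point \<Rightarrow> _"
  have "invf (rebase (move g s\<^sub>0) s\<^sub>0) = ?r"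
    by (intro inv_unique_comp rebase_rebase)
  then have "?r \<in> D"
    using D_inv[OF rebase_in_D, of "move g s\<^sub>0"] g base by simp
  moreover have "twist g = ?r \<circ> emb (half False) (twist g) \<circ> emb (half True) (twist g)"
  proof
    fix z :: "('s, 'a) point"
    obtain j y where z: "z = graft (half j) y"
      using halves_cover[of z s\<^sub>0] by blast
    have "(emb (half False) (twist g) \<circ> emb (half True) (twist g)) z = graft (half j) (twist g y)"
      unfolding z by (cases j) (simp_all add: emb_apart apart_half)
    then show "twist g z = (?r \<circ> emb (half False) (twist g) \<circ> emb (half True) (twist g)) z"
      using g by (simp add: z rebase_graft twist_graft_apply shift_word_at)
  qed
  ultimately show ?thesis
    using halves.derived_if_doubled[of "twist g" ?r] g by simp
qed


section \<open>Brick partitions\<close>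

definition brick_partition :: "('s \<Rightarrow> bool list) set \<Rightarrow> bool"
  where "brick_partition K \<longleftrightarrow> finite K \<and> K \<subseteq> addresses \<and> pairwise apart K \<and>
    (\<forall>z :: ('s, 'a) point. \<exists>\<beta>\<in>K. z \<in> range (graft \<beta>))"

definition split :: "('s \<Rightarrow> bool list) set \<Rightarrow> ('s \<Rightarrow> bool list) \<Rightarrow> 's \<Rightarrow> ('s \<Rightarrow> bool list) set"
  where "split K \<beta> s = (K - {\<beta>}) \<union> {\<beta> \<star> word_at s [False], \<beta> \<star> word_at s [True]}"

definition carries :: "(('s, 'a) point \<Rightarrow> ('s, 'a) point) \<Rightarrow> ('s \<Rightarrow> bool list) \<Rightarrow> ('s \<Rightarrow> bool list) \<Rightarrow> bool"
  where "carries F \<beta> \<gamma> \<longleftrightarrow> (\<exists>g\<in>carrier G. F \<circ> graft \<beta> = graft \<gamma> \<circ> twist g)"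

text \<open>For a member of \<open>V\<close> and two brick partitions this relation is a bijection
  between their bricks, because a brick and its image determine each other; see
  \<open>matches_card\<close>.\<close>

definition matches :: "(('s, 'a) point \<Rightarrow> ('s, 'a) point) \<Rightarrow> ('s \<Rightarrow> bool list) set \<Rightarrow> ('s \<Rightarrow> bool list) set \<Rightarrow> bool"
  where "matches F K L \<longleftrightarrow> (\<forall>\<beta>\<in>K. \<exists>\<gamma>\<in>L. carries F \<beta> \<gamma>) \<and> (\<forall>\<gamma>\<in>L. \<exists>\<beta>\<in>K. carries F \<beta> \<gamma>)"

lemma brick_partitionD:
  assumes "brick_partition K"
  shows "finite K" "\<beta> \<in> K \<Longrightarrow> \<beta> \<in> addresses" "\<beta> \<in> K \<Longrightarrow> \<gamma> \<in> K \<Longrightarrow> \<beta> \<noteq> \<gamma> \<Longrightarrow> apart \<beta> \<gamma>"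
    "\<exists>\<beta>\<in>K. (z :: ('s, 'a) point) \<in> range (graft \<beta>)"
  using assms unfolding brick_partition_def pairwise_def by blast+

lemma carries_one: "F \<circ> graft \<beta> = graft \<gamma> \<Longrightarrow> carries F \<beta> \<gamma>"
  unfolding carries_def by (intro bexI[of _ \<one>]) simp_all

lemma carries_comp: "carries F \<beta> \<gamma> \<Longrightarrow> carries H \<gamma> \<delta> \<Longrightarrow> carries (H \<circ> F) \<beta> \<delta>"
proof -
  assume "carries F \<beta> \<gamma>" "carries H \<gamma> \<delta>"
  then obtain g h where g: "g \<in> carrier G" "F \<circ> graft \<beta> = graft \<gamma> \<circ> twist g"
    and h: "h \<in> carrier G" "H \<circ> graft \<gamma> = graft \<delta> \<circ> twist h"
    unfolding carries_def by blast
  have "(H \<circ> F) \<circ> graft \<beta> = H \<circ> graft \<gamma> \<circ> twist g"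
    by (simp only: o_assoc[symmetric] g(2))
  then have "(H \<circ> F) \<circ> graft \<beta> = graft \<delta> \<circ> twist (h \<otimes> g)"
    by (simp only: h(2) twist_mult[OF h(1) g(1)] o_assoc)
  then show ?thesis
    using g h unfolding carries_def by (intro bexI[of _ "h \<otimes> g"]) simp_all
qed

lemma carries_inv:
  assumes "F \<in> V" "carries F \<beta> \<gamma>" shows "carries (invf F) \<gamma> \<beta>"
proof -
  obtain g where g: "g \<in> carrier G" "F \<circ> graft \<beta> = graft \<gamma> \<circ> twist g"
    using assms(2) unfolding carries_def by blast
  have "invf F \<circ> graft \<gamma> = graft \<beta> \<circ> twist (inv g)"
  proof
    fix x
    have "graft \<gamma> x = F (graft \<beta> (twist (inv g) x))"
      using fun_cong[OF g(2), of "twist (inv g) x"] g(1) by simp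
    then show "(invf F \<circ> graft \<gamma>) x = (graft \<beta> \<circ> twist (inv g)) x"
      using assms(1) by simp
  qed
  then show ?thesis
    using g unfolding carries_def by (intro bexI[of _ "inv g"]) simp_all
qed

lemma carries_range:
  assumes "carries F \<beta> \<gamma>" shows "F ` range (graft \<beta>) = range (graft \<gamma>)"
proof -
  obtain g where g: "g \<in> carrier G" "F \<circ> graft \<beta> = graft \<gamma> \<circ> twist g"
    using assms unfolding carries_def by blast
  have "F ` range (graft \<beta>) = range (graft \<gamma> \<circ> twist g)"
    by (simp only: image_comp g(2))
  also have "\<dots> = graft \<gamma> ` range (twist g)"
    by (simp only: image_comp)
  finally show ?thesis
    using bij_twist[OF g(1)] by (simp add: bij_is_surj)
qed

lemma carries_target_unique: "carries F \<beta> \<gamma> \<Longrightarrow> carries F \<beta> \<delta> \<Longrightarrow> \<gamma> = \<delta>"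
  by (rule range_graft_eq_imp[where 'g = 'a]) (simp only: carries_range[symmetric])

lemma carries_apart:
  assumes "F \<in> V" "carries F \<beta> \<beta>'" "carries F \<gamma> \<gamma>'" shows "apart \<beta>' \<gamma>' \<longleftrightarrow> apart \<beta> \<gamma>"
proof -
  have "range (graft \<beta>') \<inter> range (graft \<gamma>') = F ` (range (graft \<beta>) \<inter> range (graft \<gamma>))"
    using assms(1) unfolding carries_range[OF assms(2), symmetric] carries_range[OF assms(3), symmetric]
    by (simp add: image_Int V_bij bij_is_inj)
  then show ?thesis
    unfolding apart_iff_disjoint[where 'g = 'a] by simp
qed

lemma carries_source_unique:
  "F \<in> V \<Longrightarrow> brick_partition K \<Longrightarrow> \<beta> \<in> K \<Longrightarrow> \<gamma> \<in> K \<Longrightarrow> carries F \<beta> \<delta> \<Longrightarrow> carries F \<gamma> \<delta> \<Longrightarrow> \<beta> = \<gamma>"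
  using carries_apart[of F \<beta> \<delta> \<gamma> \<delta>] brick_partitionD(3) by auto

lemma matches_comp: "matches F K L \<Longrightarrow> matches H L M \<Longrightarrow> matches (H \<circ> F) K M"
  unfolding matches_def using carries_comp[of F _ _ H] by blast

lemma matches_inv: "F \<in> V \<Longrightarrow> matches F K L \<Longrightarrow> matches (invf F) L K"
  unfolding matches_def using carries_inv[of F] by blast

lemma matches_card:
  assumes "F \<in> V" "brick_partition K" "brick_partition L" "matches F K L"
  shows "card K = card L"
proof -
  obtain p where p: "\<And>\<beta>. \<beta> \<in> K \<Longrightarrow> p \<beta> \<in> L \<and> carries F \<beta> (p \<beta>)"
    using assms(4) unfolding matches_def by metis
  have "inj_on p K"
    using carries_source_unique[OF assms(1,2)] p by (metis inj_onI)
  moreover have "p ` K = L"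
    using p assms(4) carries_target_unique unfolding matches_def by blast
  ultimately show ?thesis
    using card_image by metis
qed

lemma partition_image:
  assumes F: "F \<in> V" and K: "brick_partition K" and p: "\<And>\<beta>. \<beta> \<in> K \<Longrightarrow> p \<beta> \<in> addresses \<and> carries F \<beta> (p \<beta>)"
  shows "brick_partition (p ` K)"
proof -
  have "pairwise apart (p ` K)"
  proof (rule pairwiseI)
    fix \<gamma> \<delta> assume "\<gamma> \<in> p ` K" "\<delta> \<in> p ` K" "\<gamma> \<noteq> \<delta>"
    then show "apart \<gamma> \<delta>"
      using p carries_apart[OF F] brick_partitionD(3)[OF K] by blast
  qed
  moreover have "\<exists>\<gamma>\<in>p ` K. z \<in> range (graft \<gamma>)" for z :: "('s, 'a) point"
  proof -
    obtain \<beta> where \<beta>: "\<beta> \<in> K" "invf F z \<in> range (graft \<beta>)"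
      using brick_partitionD(4)[OF K] by blast
    then have "F (invf F z) \<in> range (graft (p \<beta>))"
      using p carries_range by blast
    then show ?thesis
      using \<beta>(1) F by auto
  qed
  ultimately show ?thesis
    using p brick_partitionD(1)[OF K] unfolding brick_partition_def by blast
qed

lemma split_partition:
  assumes K: "brick_partition K" and \<beta>: "\<beta> \<in> K" and s: "s \<in> S"
  shows "brick_partition (split K \<beta> s)" "card (split K \<beta> s) = Suc (card K)"
proof -
  let ?h = "\<lambda>j. \<beta> \<star> word_at s [j]"
  have apart: "apart \<gamma> (?h j)" "apart (?h j) \<gamma>" if "\<gamma> \<in> K - {\<beta>}" for \<gamma> j
    using brick_partitionD(3)[OF K] \<beta> that apart_extend by (metis DiffD1 DiffD2 insertI1)+
  have hh: "apart (?h False) (?h True)" "apart (?h True) (?h False)"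
    by (simp_all add: apart_word_at)
  have "\<exists>\<gamma>\<in>split K \<beta> s. z \<in> range (graft \<gamma>)" for z :: "('s, 'a) point"
  proof -
    obtain \<gamma> where \<gamma>: "\<gamma> \<in> K" "z \<in> range (graft \<gamma>)"
      using brick_partitionD(4)[OF K] by blast
    show ?thesis
    proof (cases "\<gamma> = \<beta>")
      case True
      then obtain y where "z = graft \<beta> y"
        using \<gamma> by blast
      moreover obtain j x where "y = graft (word_at s [j]) x"
        using halves_cover[of y s] by blast
      ultimately have "z = graft (?h j) x"
        by (simp add: graft_cat)
      then show ?thesis
        unfolding split_def by (cases j) auto
    qed (use \<gamma> in \<open>auto simp: split_def\<close>)
  qed
  moreover have "pairwise apart (split K \<beta> s)"
  proof (rule pairwiseI)
    fix \<gamma> \<delta> assume "\<gamma> \<in> split K \<beta> s" "\<delta> \<in> split K \<beta> s" "\<gamma> \<noteq> \<delta>"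
    then show "apart \<gamma> \<delta>"
      using apart hh brick_partitionD(3)[OF K] unfolding split_def by blast
  qed
  moreover have "split K \<beta> s \<subseteq> addresses" "finite (split K \<beta> s)"
    using brick_partitionD(1,2)[OF K] \<beta> s by (auto simp: split_def)
  ultimately show "brick_partition (split K \<beta> s)"
    unfolding brick_partition_def by blast
  have "?h False \<notin> K - {\<beta>}" "?h True \<notin> K - {\<beta>}" "?h False \<noteq> ?h True"
    using apart(1) hh by (metis apart_irrefl)+
  then show "card (split K \<beta> s) = Suc (card K)"
    using card.remove[OF brick_partitionD(1)[OF K] \<beta>] brick_partitionD(1)[OF K] by (simp add: split_def)
qed

lemma partition_triv: "brick_partition {triv}"
  by (simp add: brick_partition_def)

definition tail :: "nat \<Rightarrow> 's \<Rightarrow> bool list"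
  where "tail n = word_at s\<^sub>0 (replicate n False)"

text \<open>The bricks 1, 01, 001, ... followed by the last remaining brick of n zeros, which is
  \<open>tail n\<close> and is the one split next. It is the normal form for partitions into n+1
  bricks.\<close>

fun comb :: "nat \<Rightarrow> ('s \<Rightarrow> bool list) set" where
  "comb 0 = {triv}"
| "comb (Suc n) = split (comb n) (tail n) s\<^sub>0"

lemma tail_Suc: "tail n \<star> half False = tail (Suc n)"
  by (simp add: tail_def replicate_append_same)

lemma tail_in_comb: "tail n \<in> comb n"
  by (cases n) (simp_all add: split_def flip: tail_Suc, simp add: tail_def)

lemma partition_comb: "brick_partition (comb n)"
  by (induction n) (simp_all add: partition_triv split_partition tail_in_comb base)

lemma card_comb: "card (comb n) = Suc n"
  by (induction n) (simp_all add: split_partition partition_comb tail_in_comb base)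

lemma matches_swp:
  assumes K: "brick_partition K" and \<alpha>: "\<alpha> \<in> K" and \<beta>: "\<beta> \<in> K"
  shows "matches (swp \<alpha> \<beta>) K K"
proof -
  have "\<exists>\<delta>\<in>K. carries (swp \<alpha> \<beta>) \<gamma> \<delta> \<and> carries (swp \<alpha> \<beta>) \<delta> \<gamma>" if \<gamma>: "\<gamma> \<in> K" for \<gamma>
  proof -
    have *: "swp \<alpha> \<beta> \<circ> graft \<alpha> = graft \<beta>" "swp \<alpha> \<beta> \<circ> graft \<beta> = graft \<alpha>"
      using brick_partitionD(3)[OF K \<alpha> \<beta>] by (cases "\<alpha> = \<beta>"; auto simp: swp_right)+
    show ?thesis
    proof (cases "\<gamma> = \<alpha> \<or> \<gamma> = \<beta>")
      case False
      then have "swp \<alpha> \<beta> \<circ> graft \<gamma> = graft \<gamma>"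
        using brick_partitionD(3)[OF K _ \<gamma>] \<alpha> \<beta> by (auto simp: swp_graft_apart)
      then show ?thesis
        using carries_one \<gamma> by blast
    qed (use carries_one * \<alpha> \<beta> in blast)
  qed
  then show ?thesis
    unfolding matches_def by blast
qed

lemma matches_emb_twist:
  assumes K: "brick_partition K" and \<beta>: "\<beta> \<in> K" and g: "g \<in> carrier G"
  shows "matches (emb \<beta> (twist g)) K K"
proof -
  have "carries (emb \<beta> (twist g)) \<gamma> \<gamma>" if \<gamma>: "\<gamma> \<in> K" for \<gamma>
  proof (cases "\<gamma> = \<beta>")
    case True
    then show ?thesis
      using g unfolding carries_def by (intro bexI[of _ g]) auto
  next
    case False
    then have "emb \<beta> (twist g) \<circ> graft \<gamma> = graft \<gamma>"
      using brick_partitionD(3)[OF K \<beta> \<gamma>] by (auto simp: emb_graft_apart)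
    then show ?thesis
      by (rule carries_one)
  qed
  then show ?thesis
    unfolding matches_def by blast
qed

text \<open>Such a map permutes the bricks of \<open>K\<close> and twists each by an element of
  \<open>G\<close>. Transpositions and copies of twists, all in \<open>D\<close>, undo this one
  brick at a time; the induction counts the bricks that are not yet fixed pointwise.\<close>

lemma matches_self_in_D:
  assumes "brick_partition K" "F \<in> V" "matches F K K" shows "F \<in> D"
  using assms
proof (induction "card {\<beta> \<in> K. F \<circ> graft \<beta> \<noteq> graft \<beta>}" arbitrary: F rule: less_induct)
  case less
  note K = \<open>brick_partition K\<close> and F = \<open>F \<in> V\<close>
  show ?case
  proof (cases "\<exists>\<beta>\<in>K. F \<circ> graft \<beta> \<noteq> graft \<beta>")
    case False
    have "F z = z" for z
    proof -
      obtain \<beta> y where "\<beta> \<in> K" "z = graft \<beta> y"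
        using brick_partitionD(4)[OF K] by blast
      then show ?thesis
        using False by (metis comp_apply)
    qed
    then have "F = id" by auto
    then show ?thesis by (simp add: D_id)
  next
    case True
    then obtain \<beta> where \<beta>: "\<beta> \<in> K" "F \<circ> graft \<beta> \<noteq> graft \<beta>" by blast
    then obtain \<gamma> where \<gamma>: "\<gamma> \<in> K" "carries F \<beta> \<gamma>"
      using less.prems(3) unfolding matches_def by blast
    then obtain g where g: "g \<in> carrier G" "F \<circ> graft \<beta> = graft \<gamma> \<circ> twist g"
      unfolding carries_def by blast
    \<comment> \<open>Brings the image \<gamma> of \<beta> back to \<beta> and then removes the
      twist by g.\<close>
    define H where "H = emb \<beta> (twist (inv g)) \<circ> swp \<beta> \<gamma>"
    have ad: "\<beta> \<in> addresses" "\<gamma> \<in> addresses"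
      using brick_partitionD(2)[OF K] \<beta> \<gamma> by auto
    have \<beta>\<gamma>: "\<beta> = \<gamma> \<or> apart \<beta> \<gamma>"
      using brick_partitionD(3)[OF K] \<beta>(1) \<gamma>(1) by blast
    have H: "H \<in> D"
      unfolding H_def using ad g(1) \<beta>\<gamma> by (intro D_comp emb_in_D twist_in_D swp_in_D) simp_all
    have "matches (H \<circ> F) K K"
      unfolding H_def using K \<beta>(1) \<gamma>(1) g(1)
      by (intro matches_comp[OF less.prems(3)] matches_comp[OF matches_swp] matches_emb_twist) simp_all
    moreover have "H \<circ> F \<in> V"
      using H F by (simp add: D_in_V)
    moreover have "{\<delta> \<in> K. H \<circ> F \<circ> graft \<delta> \<noteq> graft \<delta>} \<subset> {\<delta> \<in> K. F \<circ> graft \<delta> \<noteq> graft \<delta>}"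
    proof
      have "H \<circ> F \<circ> graft \<beta> = graft \<beta>"
      proof
        fix x
        have "swp \<beta> \<gamma> (graft \<gamma> y) = graft \<beta> y" for y :: "('s, 'a) point"
          using \<beta>\<gamma> by (auto simp: swp_right)
        then show "(H \<circ> F \<circ> graft \<beta>) x = graft \<beta> x"
          using fun_cong[OF g(2), of x] g(1) by (simp add: H_def)
      qed
      then show "{\<delta> \<in> K. H \<circ> F \<circ> graft \<delta> \<noteq> graft \<delta>} \<noteq> {\<delta> \<in> K. F \<circ> graft \<delta> \<noteq> graft \<delta>}"
        using \<beta> by blast
      \<comment> \<open>A brick that was fixed before is neither \<beta> nor \<gamma>: were \<gamma>
        fixed, both \<beta> and \<gamma> would be carried to \<gamma>. So \<open>H\<close> is the
        identity on it.\<close>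
      have "H \<circ> F \<circ> graft \<delta> = graft \<delta>" if \<delta>: "\<delta> \<in> K" "F \<circ> graft \<delta> = graft \<delta>" for \<delta>
      proof -
        have "\<delta> \<noteq> \<beta>"
          using \<delta> \<beta> by blast
        moreover have "\<delta> \<noteq> \<gamma>"
          using carries_source_unique[OF F K \<beta>(1) \<delta>(1) \<gamma>(2)] carries_one[OF \<delta>(2)] \<open>\<delta> \<noteq> \<beta>\<close> by blast
        ultimately have "apart \<beta> \<delta>" "apart \<gamma> \<delta>"
          using brick_partitionD(3)[OF K] \<beta>(1) \<gamma>(1) \<delta>(1) by blast+
        then show ?thesis
          using fun_cong[OF \<delta>(2)] by (auto simp: fun_eq_iff H_def swp_apart emb_apart)
      qed
      then show "{\<delta> \<in> K. H \<circ> F \<circ> graft \<delta> \<noteq> graft \<delta>} \<subseteq> {\<delta> \<in> K. F \<circ> graft \<delta> \<noteq> graft \<delta>}"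
        by blast
    qed
    then have "card {\<delta> \<in> K. H \<circ> F \<circ> graft \<delta> \<noteq> graft \<delta>} < card {\<delta> \<in> K. F \<circ> graft \<delta> \<noteq> graft \<delta>}"
      using brick_partitionD(1)[OF K] by (intro psubset_card_mono) auto
    ultimately have "H \<circ> F \<in> D"
      using less.hyps K by blast
    then show ?thesis
      using D_cancel_left[OF H F] by blast
  qed
qed

text \<open>Modulo commutators the coordinate in which a brick is split is irrelevant.\<close>

lemma matches_split:
  assumes F: "F \<in> V" and K: "brick_partition K" and m: "matches F K (comb n)" and \<beta>: "\<beta> \<in> K" and s: "s \<in> S"
  shows "\<exists>H\<in>D. matches (H \<circ> F) (split K \<beta> s) (comb (Suc n))"
proof -
  obtain \<gamma> where \<gamma>: "\<gamma> \<in> comb n" "carries F \<beta> \<gamma>"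
    using m \<beta> unfolding matches_def by blast
  \<comment> \<open>The comb grows only at its tail, so the image of the brick to be split is first
    moved there.\<close>
  define P where "P = (swp \<gamma> (tail n) :: ('s, 'a) point \<Rightarrow> _)"
  have half_in_split: "\<gamma> \<star> word_at t [j] \<in> split L \<gamma> t" for L \<gamma> t j
    by (cases j) (simp_all add: split_def)
  note comb = partition_comb[of n] and t = tail_in_comb[of n]
  have P: "P \<in> D"
    unfolding P_def using brick_partitionD(2,3)[OF comb] \<gamma>(1) t by (intro swp_in_D) auto
  have PF: "P \<circ> F \<in> V" "matches (P \<circ> F) K (comb n)"
    using F D_in_V[OF P] matches_comp[OF m matches_swp[OF comb \<gamma>(1) t]] by (simp_all add: P_def)
  have "carries (P \<circ> F) \<beta> (tail n)"
    by (rule carries_comp[OF \<gamma>(2)]) (auto simp: P_def fun_eq_iff intro: carries_one)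
  then obtain g where g: "g \<in> carrier G" and PFg: "P \<circ> F \<circ> graft \<beta> = graft (tail n) \<circ> twist g"
    unfolding carries_def by blast
  \<comment> \<open>Halves of \<beta> in coordinate s arrive as halves of the tail in coordinate
    \<open>move g s\<close>; rebasing inside the tail turns them into halves in
    \<open>s\<^sub>0\<close>.\<close>
  define R where "R = emb (tail n) (rebase (move g s) s\<^sub>0 :: ('s, 'a) point \<Rightarrow> _)"
  have R: "R \<in> D"
    unfolding R_def using g s brick_partitionD(2)[OF comb t] by (intro emb_in_D rebase_in_D) simp_all
  have halves: "carries (R \<circ> (P \<circ> F)) (\<beta> \<star> word_at s [j]) (tail n \<star> half j)" for j
  proof -
    have "carries (P \<circ> F) (\<beta> \<star> word_at s [j]) (tail n \<star> word_at (move g s) [j])"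
      using canonical_extend[OF PFg, of "word_at s [j]"] g
      unfolding carries_def by (auto simp: shift_word_at)
    moreover have "carries R (tail n \<star> word_at (move g s) [j]) (tail n \<star> half j)"
      by (rule carries_one) (auto simp: R_def fun_eq_iff graft_cat rebase_graft)
    ultimately show ?thesis
      by (rule carries_comp)
  qed
  \<comment> \<open>Every other brick of \<open>K\<close> lands off the tail, where \<open>R\<close>
    is the identity.\<close>
  have others: "carries (R \<circ> (P \<circ> F)) \<delta> \<epsilon> \<and> \<epsilon> \<noteq> tail n"
    if "\<delta> \<in> K - {\<beta>}" "\<epsilon> \<in> comb n" "carries (P \<circ> F) \<delta> \<epsilon>" for \<delta> \<epsilon>
  proof -
    have "\<epsilon> \<noteq> tail n"
      using carries_source_unique[OF PF(1) K, of \<delta> \<beta>] that \<beta> \<open>carries (P \<circ> F) \<beta> (tail n)\<close> by blast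
    then have "R \<circ> graft \<epsilon> = graft \<epsilon>"
      using brick_partitionD(3)[OF comb t that(2)] by (auto simp: R_def emb_graft_apart)
    with \<open>\<epsilon> \<noteq> tail n\<close> show ?thesis
      using carries_comp[OF that(3) carries_one] by blast
  qed
  have "matches (R \<circ> (P \<circ> F)) (split K \<beta> s) (comb (Suc n))"
    unfolding matches_def comb.simps
  proof (intro conjI ballI)
    fix \<delta> assume "\<delta> \<in> split K \<beta> s"
    then consider j where "\<delta> = \<beta> \<star> word_at s [j]" | "\<delta> \<in> K - {\<beta>}"
      unfolding split_def by blast
    then show "\<exists>\<epsilon>\<in>split (comb n) (tail n) s\<^sub>0. carries (R \<circ> (P \<circ> F)) \<delta> \<epsilon>"
    proof cases
      case (1 j)
      then show ?thesis
        using halves[of j] half_in_split by blast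
    next
      case 2
      then obtain \<epsilon> where "\<epsilon> \<in> comb n" "carries (P \<circ> F) \<delta> \<epsilon>"
        using PF(2) unfolding matches_def by blast
      then show ?thesis
        using others[OF 2] unfolding split_def by blast
    qed
  next
    fix \<epsilon> assume "\<epsilon> \<in> split (comb n) (tail n) s\<^sub>0"
    then consider j where "\<epsilon> = tail n \<star> half j" | "\<epsilon> \<in> comb n - {tail n}"
      unfolding split_def by blast
    then show "\<exists>\<delta>\<in>split K \<beta> s. carries (R \<circ> (P \<circ> F)) \<delta> \<epsilon>"
    proof cases
      case (1 j)
      then show ?thesis
        using halves[of j] half_in_split by blast
    next
      case 2
      then obtain \<delta> where \<delta>: "\<delta> \<in> K" "carries (P \<circ> F) \<delta> \<epsilon>"
        using PF(2) unfolding matches_def by blast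
      then have "\<delta> \<noteq> \<beta>"
        using carries_target_unique \<open>carries (P \<circ> F) \<beta> (tail n)\<close> 2 by blast
      then show ?thesis
        using others[of \<delta> \<epsilon>] \<delta> 2 unfolding split_def by blast
    qed
  qed
  then have "matches ((R \<circ> P) \<circ> F) (split K \<beta> s) (comb (Suc n))"
    by (simp only: o_assoc)
  then show ?thesis
    using D_comp[OF R P] by blast
qed


section \<open>Grids\<close>

text \<open>For finite \<open>T\<close> within S this is a common refinement of all partitions whose
  addresses are \<open>coarser T N\<close>.\<close>

definition grid :: "'s set \<Rightarrow> nat \<Rightarrow> ('s \<Rightarrow> bool list) set"
  where "grid T N = {\<beta>. \<forall>s. length (\<beta> s) = (if s \<in> T then N else 0)}"

definition coarser :: "'s set \<Rightarrow> nat \<Rightarrow> ('s \<Rightarrow> bool list) \<Rightarrow> bool"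
  where "coarser T N \<beta> \<longleftrightarrow> (\<forall>s. length (\<beta> s) \<le> (if s \<in> T then N else 0))"

text \<open>Bricks are split until all have full depth, while \<open>matches_split\<close> keeps the
  image a comb modulo \<open>D\<close>. That the grid is a partition comes out of the same
  induction.\<close>

lemma matches_grid:
  assumes T: "finite T" "T \<subseteq> S"
    and "brick_partition K" "\<And>\<beta>. \<beta> \<in> K \<Longrightarrow> coarser T N \<beta>" "F \<in> V" "matches F K (comb n)"
  shows "brick_partition (grid T N) \<and> (\<exists>H\<in>D. \<exists>m. matches (H \<circ> F) (grid T N) (comb m))"
  using assms(3-)
\<comment> \<open>A brick lacking d letters weighs 3^d. A split replaces it by two bricks lacking d
  - 1 letters, of total weight at most 2 * 3^(d-1); with base 3 this is a strict decrease.\<close>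
proof (induction "\<Sum>\<beta>\<in>K. 3 ^ (\<Sum>s\<in>T. N - length (\<beta> s)) :: nat" arbitrary: K F n rule: less_induct)
  case less
  note K = \<open>brick_partition K\<close> and F = \<open>F \<in> V\<close>
  define d where "d \<beta> = (\<Sum>s\<in>T. N - length (\<beta> s))" for \<beta> :: "'s \<Rightarrow> bool list"
  show ?case
  proof (cases "K \<subseteq> grid T N")
    case True
    \<comment> \<open>Each grid brick meets a brick of \<open>K\<close>, and two meeting bricks with
      words of equal lengths coincide.\<close>
    have "grid T N \<subseteq> K"
    proof
      fix \<gamma> assume \<gamma>: "\<gamma> \<in> grid T N"
      define z :: "('s, 'a) point" where "z = graft \<gamma> undefined"
      obtain \<beta> where \<beta>: "\<beta> \<in> K" "z \<in> range (graft \<beta>)"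
        using brick_partitionD(4)[OF K] by blast
      have "z \<in> range (graft \<gamma>)"
        by (simp add: z_def)
      moreover have len: "length (\<beta> s) = length (\<gamma> s)" for s
        using subsetD[OF True \<beta>(1)] \<gamma> by (simp add: grid_def)
      ultimately have "\<beta> s = \<gamma> s" for s
        using \<beta>(2) unfolding range_graft by (intro nth_equalityI) metis+
      then have "\<beta> = \<gamma>"
        by blast
      then show "\<gamma> \<in> K"
        using \<beta>(1) by simp
    qed
    then have "K = grid T N"
      using True by blast
    then show ?thesis
      using K less.prems(4) D_id by (intro conjI bexI[of _ id] exI[of _ n]) simp_all
  next
    case False
    then obtain \<beta> s where \<beta>: "\<beta> \<in> K" and "length (\<beta> s) \<noteq> (if s \<in> T then N else 0)"
      unfolding grid_def by blast
    then have s: "s \<in> T" and len: "length (\<beta> s) < N"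
      using less.prems(2)[OF \<beta>] by (auto simp: coarser_def le_less split: if_splits)
    have sS: "s \<in> S"
      using s T by blast
    let ?h = "\<lambda>j. \<beta> \<star> word_at s [j]"
    obtain H where H: "H \<in> D" "matches (H \<circ> F) (split K \<beta> s) (comb (Suc n))"
      using matches_split[OF F K less.prems(4) \<beta> sS] by blast
    have dh: "Suc (d (?h j)) = d \<beta>" for j
    proof -
      have "d \<gamma> = (N - length (\<gamma> s)) + (\<Sum>t\<in>T - {s}. N - length (\<gamma> t))" for \<gamma>
        using T(1) s by (simp add: d_def sum.remove)
      moreover have "(\<Sum>t\<in>T - {s}. N - length (?h j t)) = (\<Sum>t\<in>T - {s}. N - length (\<beta> t))"
        by (rule sum.cong) (auto simp: cat_def word_at_def)
      moreover have "length (?h j s) = Suc (length (\<beta> s))"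
        by (simp add: cat_def word_at_def)
      ultimately show ?thesis
        using len by simp
    qed
    have "(\<Sum>\<gamma>\<in>split K \<beta> s. 3 ^ d \<gamma>) \<le> (\<Sum>\<gamma>\<in>K - {\<beta>}. 3 ^ d \<gamma>) + (\<Sum>\<gamma>\<in>{?h False, ?h True}. 3 ^ d \<gamma> :: nat)"
      unfolding split_def using brick_partitionD(1)[OF K] by (subst sum_Un_nat) simp_all
    also have "(\<Sum>\<gamma>\<in>{?h False, ?h True}. 3 ^ d \<gamma> :: nat) \<le> 3 ^ d (?h False) + 3 ^ d (?h True)"
      by (simp add: sum.insert_if)
    also have "\<dots> < 3 ^ d \<beta>"
    proof -
      have "d (?h False) = d (?h True)" "d \<beta> = Suc (d (?h True))"
        using dh[of False] dh[of True] by linarith+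
      then show ?thesis
        by (simp only:) simp
    qed
    also have "(\<Sum>\<gamma>\<in>K - {\<beta>}. 3 ^ d \<gamma>) + 3 ^ d \<beta> = (\<Sum>\<gamma>\<in>K. 3 ^ d \<gamma> :: nat)"
      using sum.remove[OF brick_partitionD(1)[OF K] \<beta>, of "\<lambda>\<gamma>. 3 ^ d \<gamma> :: nat"] by simp
    finally have decrease: "(\<Sum>\<gamma>\<in>split K \<beta> s. 3 ^ d \<gamma>) < (\<Sum>\<gamma>\<in>K. 3 ^ d \<gamma> :: nat)"
      by simp
    have "coarser T N \<gamma>" if "\<gamma> \<in> split K \<beta> s" for \<gamma>
    proof -
      have "coarser T N (?h j)" for j
        unfolding coarser_def
      proof
        fix t
        show "length (?h j t) \<le> (if t \<in> T then N else 0)"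
          using less.prems(2)[OF \<beta>, unfolded coarser_def, rule_format, of t] len s
          by (simp add: cat_def word_at_def split: if_splits)
      qed
      then show ?thesis
        using that less.prems(2) unfolding split_def by blast
    qed
    then have "brick_partition (grid T N) \<and> (\<exists>H'\<in>D. \<exists>m. matches (H' \<circ> (H \<circ> F)) (grid T N) (comb m))"
      using H F D_in_V split_partition(1)[OF K \<beta> sS] decrease
      by (intro less.hyps[of "split K \<beta> s" "H \<circ> F" "Suc n"]) (simp_all add: d_def)
    then obtain H' m where "brick_partition (grid T N)" "H' \<in> D" "matches ((H' \<circ> H) \<circ> F) (grid T N) (comb m)"
      by (auto simp: o_assoc)
    then show ?thesis
      using D_comp[OF _ H(1)] by blast
  qed
qed

lemma coarser_bound:
  assumes "finite K" "K \<subseteq> addresses"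
  obtains T N where "finite T" "T \<subseteq> S" "\<And>\<beta>. \<beta> \<in> K \<Longrightarrow> coarser T N \<beta>"
proof
  define T where "T = (\<Union>\<beta>\<in>K. {s. \<beta> s \<noteq> []})"
  \<comment> \<open>The inserted 0 keeps the maximum defined when \<open>T\<close> is empty, as for
    the trivial partition.\<close>
  define N where "N = Max (insert 0 ((\<lambda>(\<beta>, s). length (\<beta> s)) ` (K \<times> T)))"
  show T: "finite T" "T \<subseteq> S"
    using assms by (auto simp: T_def addresses_def)
  show "coarser T N \<beta>" if "\<beta> \<in> K" for \<beta>
    unfolding coarser_def
  proof
    fix s
    show "length (\<beta> s) \<le> (if s \<in> T then N else 0)"
    proof (cases "s \<in> T")
      case True
      then have "length (\<beta> s) \<le> N"
        unfolding N_def using assms T that by (intro Max_ge) force+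
      then show ?thesis
        using True by simp
    qed (use that in \<open>auto simp: T_def\<close>)
  qed
qed

section \<open>Compactness of the cube\<close>

lemma open_cylinder: "open {w :: nat \<Rightarrow> bool. \<forall>i<length u. w i = u ! i}"
proof -
  have "open (Pi\<^sub>E UNIV (\<lambda>i. if i < length u then {u ! i} else UNIV))"
    by (rule open_PiE) (auto intro!: finite_subset[of _ "{..<length u}"] open_discrete split: if_splits)
  also have "Pi\<^sub>E UNIV (\<lambda>i. if i < length u then {u ! i} else UNIV) = {w. \<forall>i<length u. w i = u ! i}"
    by (auto simp: PiE_UNIV_domain Pi_def split: if_splits)
  finally show ?thesis .
qed

text \<open>Tychonoff's theorem twice: over the positions of a word, then over the
  coordinates.\<close>

lemma compact_cube: "compact (UNIV :: ('s \<Rightarrow> bool word) set)"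
proof -
  have "compact_space (euclidean :: bool topology)"
    by (simp add: compact_space_def finite_imp_compact)
  then have "compact_space (euclidean :: (nat \<Rightarrow> bool) topology)"
    by (subst euclidean_product_topology[symmetric]) (simp add: compact_space_product_topology)
  then have "compact_space (euclidean :: ('s \<Rightarrow> nat \<Rightarrow> bool) topology)"
    by (subst euclidean_product_topology[symmetric]) (simp add: compact_space_product_topology)
  then show ?thesis
    by (simp add: compact_space_def)
qed

text \<open>A Lebesgue number argument: finitely many bricks with property \<open>P\<close> cover
  the cube, and every brick of a grid deeper than all of them lies inside one of these.\<close>

lemma fine_grid:
  assumes hereditary: "\<And>\<alpha> \<chi>. P \<alpha> \<Longrightarrow> \<chi> \<in> addresses \<Longrightarrow> P (\<alpha> \<star> \<chi>)"
    and cover: "\<And>z :: ('s, 'a) point. \<exists>\<alpha>\<in>addresses. z \<in> range (graft \<alpha>) \<and> P \<alpha>"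
  obtains T N where "finite T" "T \<subseteq> S" "\<And>\<beta>. \<beta> \<in> grid T N \<Longrightarrow> P \<beta>"
proof -
  define U where "U \<alpha> = {\<kappa> :: 's \<Rightarrow> bool word. \<forall>s. \<forall>i<length (\<alpha> s). \<kappa> s i = \<alpha> s ! i}"
    for \<alpha> :: "'s \<Rightarrow> bool list"
  define A where "A = {\<alpha> \<in> addresses. P \<alpha>}"
  have "open (U \<alpha>)" if "\<alpha> \<in> A" for \<alpha>
  proof -
    have "open (Pi\<^sub>E UNIV (\<lambda>s. {w. \<forall>i<length (\<alpha> s). w i = \<alpha> s ! i}))"
      using that by (intro open_PiE open_cylinder)
        (auto simp: A_def addresses_def elim!: rev_finite_subset)
    also have "Pi\<^sub>E UNIV (\<lambda>s. {w. \<forall>i<length (\<alpha> s). w i = \<alpha> s ! i}) = U \<alpha>"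
      by (auto simp: PiE_UNIV_domain Pi_def U_def)
    finally show ?thesis .
  qed
  note opens = this
  have covers: "UNIV \<subseteq> (\<Union>\<alpha>\<in>A. U \<alpha>)"
  proof
    fix \<kappa> :: "'s \<Rightarrow> bool word"
    show "\<kappa> \<in> (\<Union>\<alpha>\<in>A. U \<alpha>)"
      using cover[of "(\<kappa>, undefined)"] unfolding range_graft A_def U_def by auto
  qed
  obtain A' where A': "A' \<subseteq> A" "finite A'" "UNIV \<subseteq> (\<Union>\<alpha>\<in>A'. U \<alpha>)"
    using compactE_image[OF compact_cube opens covers] by blast
  obtain T N where T: "finite T" "T \<subseteq> S" and N: "\<And>\<beta>. \<beta> \<in> A' \<Longrightarrow> coarser T N \<beta>"
    using coarser_bound[of A'] A' by (auto simp: A_def)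
  have "P \<beta>" if \<beta>: "\<beta> \<in> grid T N" for \<beta>
  proof -
    \<comment> \<open>A sample point of the brick of \<beta>, continued by zeros. A covering brick
      \<alpha> that contains it has words no longer than those of \<beta>, so \<beta> extends
      \<alpha>.\<close>
    define \<kappa> where "\<kappa> s i = (i < length (\<beta> s) \<and> \<beta> s ! i)" for s i
    obtain \<alpha> where \<alpha>: "\<alpha> \<in> A'" "\<kappa> \<in> U \<alpha>"
      using A'(3) by blast
    define \<chi> where "\<chi> s = drop (length (\<alpha> s)) (\<beta> s)" for s
    have le: "length (\<alpha> s) \<le> length (\<beta> s)" for s
      using N[OF \<alpha>(1)] \<beta> by (simp add: coarser_def grid_def)
    have "take (length (\<alpha> s)) (\<beta> s) = \<alpha> s" for s
    proof (rule nth_equalityI)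
      fix i assume "i < length (take (length (\<alpha> s)) (\<beta> s))"
      then have "i < length (\<alpha> s)" "i < length (\<beta> s)"
        by simp_all
      moreover from this have "\<kappa> s i = \<alpha> s ! i"
        using \<alpha>(2) unfolding U_def by blast
      ultimately show "take (length (\<alpha> s)) (\<beta> s) ! i = \<alpha> s ! i"
        by (simp add: \<kappa>_def)
    qed (use le[of s] in simp)
    then have "\<beta> = \<alpha> \<star> \<chi>"
      by (metis (no_types) \<chi>_def append_take_drop_id cat_def ext)
    moreover have "\<chi> \<in> addresses"
    proof -
      have "{s. \<chi> s \<noteq> []} \<subseteq> T"
      proof
        fix s assume "s \<in> {s. \<chi> s \<noteq> []}"
        then have "\<beta> s \<noteq> []"
          by (auto simp: \<chi>_def)
        then show "s \<in> T"
          using \<beta> by (auto simp: grid_def split: if_splits)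
      qed
      then show ?thesis
        using T unfolding addresses_def by (blast intro: finite_subset)
    qed
    ultimately show ?thesis
      using hereditary[of \<alpha> \<chi>] \<alpha>(1) A'(1) by (auto simp: A_def)
  qed
  then show ?thesis
    using that T by blast
qed

section \<open>Finite tables and perfectness\<close>

lemma grid_from_root:
  assumes "finite T" "T \<subseteq> S"
  shows "brick_partition (grid T N)" "\<exists>H\<in>D. \<exists>n. matches H (grid T N) (comb n)"
proof -
  have "matches id {triv} (comb 0)"
    by (auto simp: matches_def intro: carries_one)
  with matches_grid[OF assms partition_triv, of N id 0]
  show "brick_partition (grid T N)" "\<exists>H\<in>D. \<exists>n. matches H (grid T N) (comb n)"
    by (auto simp: coarser_def)
qed

text \<open>The source of a finite table can be taken to be a grid. A grid arises from the trivial
  partition by splits, so some element of \<open>D\<close> maps it onto a comb.\<close>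

lemma canonical_table:
  assumes F: "F \<in> V"
  obtains K p where "brick_partition K" "\<And>\<beta>. \<beta> \<in> K \<Longrightarrow> p \<beta> \<in> addresses \<and> carries F \<beta> (p \<beta>)"
    "\<exists>H\<in>D. \<exists>n. matches H K (comb n)"
proof -
  obtain T N where T: "finite T" "T \<subseteq> S" and can: "\<And>\<beta>. \<beta> \<in> grid T N \<Longrightarrow> canonical F \<beta>"
    using fine_grid[of "canonical F", OF canonical_cat] F unfolding V_def by auto
  obtain p where "\<And>\<beta>. \<beta> \<in> grid T N \<Longrightarrow> p \<beta> \<in> addresses \<and> carries F \<beta> (p \<beta>)"
    using can unfolding canonical_def carries_def by metis
  with grid_from_root[OF T] show ?thesis
    using that by blast
qed

theorem V_perfect:
  assumes F: "F \<in> V" shows "F \<in> D"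
proof -
  obtain K p H n where K: "brick_partition K"
    and p: "\<And>\<beta>. \<beta> \<in> K \<Longrightarrow> p \<beta> \<in> addresses \<and> carries F \<beta> (p \<beta>)"
    and H: "H \<in> D" "matches H K (comb n)"
    using canonical_table[OF F] by metis
  note pK = partition_image[OF F K p]
  \<comment> \<open>Going back along \<open>F\<close> and then along \<open>H\<close> maps the
    target partition of the table onto a comb, so this partition too can be refined to a grid by
    \<open>matches_grid\<close>.\<close>
  have "matches F K (p ` K)"
    using p unfolding matches_def by blast
  from matches_comp[OF matches_inv[OF F this] H(2)]
  have m: "matches (H \<circ> invf F) (p ` K) (comb n)" .
  have HF: "H \<circ> invf F \<in> V"
    using F H D_in_V by simp
  obtain T N where T: "finite T" "T \<subseteq> S" and N: "\<And>\<beta>. \<beta> \<in> p ` K \<Longrightarrow> coarser T N \<beta>"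
    using coarser_bound[of "p ` K"] brick_partitionD(1,2)[OF pK] by blast
  obtain I k where I: "I \<in> D" "matches (I \<circ> (H \<circ> invf F)) (grid T N) (comb k)"
    using matches_grid[OF T pK N HF m] by blast
  \<comment> \<open>The same grid is mapped onto a comb by an element of \<open>D\<close> alone.
    Both combs have as many bricks as the grid, so they coincide, and the two maps differ by one
    that permutes the bricks of a comb.\<close>
  obtain J l where J: "J \<in> D" "matches J (grid T N) (comb l)"
    using grid_from_root(2)[OF T] by blast
  note grid = grid_from_root(1)[OF T, of N]
  have IHF: "I \<circ> (H \<circ> invf F) \<in> V"
    using I HF D_in_V by simp
  have "k = l"
    using matches_card[OF IHF grid partition_comb I(2)] matches_card[OF _ grid partition_comb J(2)] J(1) D_in_V
    by (simp add: card_comb)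
  then have "matches ((I \<circ> (H \<circ> invf F)) \<circ> invf J) (comb k) (comb k)"
    using J D_in_V by (intro matches_comp[OF matches_inv I(2)]) simp_all
  then have "(I \<circ> (H \<circ> invf F)) \<circ> invf J \<in> D"
    using IHF J D_in_V by (intro matches_self_in_D[OF partition_comb]) simp_all
  from D_comp[OF this J(1)] have "((I \<circ> (H \<circ> invf F)) \<circ> invf J) \<circ> J \<in> D" .
  then have "I \<circ> (H \<circ> invf F) \<in> D"
    using J(1) D_in_V by (simp add: o_assoc[symmetric])
  then have "invf F \<in> D"
    using D_cancel_left I(1) H(1) HF V_inv[OF F] by metis
  then have "invf (invf F) \<in> D"
    by (rule D_inv)
  then show ?thesis
    using F by (simp add: inv_inv_eq V_bij)
qed

section \<open>Decomposition into commutators\<close>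

lemma supported_in_brick:
  assumes F: "F \<in> V" and \<beta>: "\<beta> \<in> addresses" and outside: "\<And>z. z \<notin> range (graft \<beta>) \<Longrightarrow> F z = z"
  obtains Y where "Y \<in> V" "F = emb \<beta> Y"
proof
  \<comment> \<open>This is \<open>F\<close> read inside the brick. \<open>F\<close> preserves the
    brick: if an image fell outside, it would be a fixed point, and injectivity would make it equal
    to its preimage.\<close>
  define Y where "Y y = invf (graft \<beta>) (F (graft \<beta> y))" for y
  have F_inj: "F y = F z \<longleftrightarrow> y = z" for y z
    using inj_eq[OF bij_is_inj[OF V_bij[OF F]]] .
  have "F (graft \<beta> y) \<in> range (graft \<beta>)" for y
  proof (rule ccontr)
    assume n: "F (graft \<beta> y) \<notin> range (graft \<beta>)"
    from outside[OF n] have "F (graft \<beta> y) = graft \<beta> y"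
      by (simp only: F_inj)
    then show False
      using n by simp
  qed
  then have Y: "graft \<beta> (Y y) = F (graft \<beta> y)" for y
    by (simp add: Y_def f_inv_into_f)
  show "F = emb \<beta> Y"
  proof
    fix z show "F z = emb \<beta> Y z"
      using outside[of z] Y by (cases "z \<in> range (graft \<beta>)") (auto simp: emb_outside)
  qed
  show "Y \<in> V"
  proof (rule V_I)
    show "bij Y"
    proof (rule bijI)
      show "inj Y"
        by (rule injI) (metis Y F_inj graft_eq_iff)
      have "\<exists>y. Y y = x" for x
      proof -
        obtain z where z: "F z = graft \<beta> x"
          using F by (metis V_bij bij_pointE)
        then have "z \<in> range (graft \<beta>)"
          using outside[of z] by (metis rangeI)
        then show ?thesis
          using z by (metis Y graft_eq_iff rangeE)
      qed
      then show "surj Y"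
        by (metis surjI)
    qed
    fix y :: "('s, 'a) point"
    obtain \<chi> \<phi> g where *: "\<chi> \<in> addresses" "graft \<beta> y \<in> range (graft (\<beta> \<star> \<chi>))" "\<phi> \<in> addresses"
      "g \<in> carrier G" "F \<circ> graft (\<beta> \<star> \<chi>) = graft (\<beta> \<star> \<phi>) \<circ> twist g"
      using V_local[OF F \<beta> _ \<beta>, of "graft \<beta> y"] Y by (metis rangeI)
    have "Y \<circ> graft \<chi> = graft \<phi> \<circ> twist g"
    proof
      fix x
      have "graft \<beta> (Y (graft \<chi> x)) = graft \<beta> (graft \<phi> (twist g x))"
        using fun_cong[OF *(5), of x] by (simp add: Y graft_cat)
      then show "(Y \<circ> graft \<chi>) x = (graft \<phi> \<circ> twist g) x"
        by simp
    qed
    moreover have "y \<in> range (graft \<chi>)"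
      using *(2) by (auto simp: graft_cat)
    ultimately show "\<exists>\<alpha>\<in>addresses. y \<in> range (graft \<alpha>) \<and> canonical Y \<alpha>"
      using * canonicalI by blast
  qed
qed

text \<open>On a small brick \<open>Q\<close> the map \<open>F\<close> agrees with \<open>M\<close>,
  a product of two commutators. The quotient fixes \<open>Q\<close> pointwise, so it is conjugate to
  an element supported in the half 0, and \<open>commutator_product_half\<close> writes that as two
  more.\<close>

theorem V_commutator_product:
  assumes F: "F \<in> V" shows "V.commutator_product 4 F"
proof -
  \<comment> \<open>Starting from a point of the half 0 keeps \<open>Q\<close> disjoint from the
    half 1, so that the two can be transposed.\<close>
  define z :: "('s, 'a) point" where "z = graft (half False) undefined"
  define a where "a = fst z s\<^sub>0"
  define b where "b = fst (F z) s\<^sub>0"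
  have a0: "a 0 = False"
    by (simp add: a_def z_def graft_def word_at_def)
  define A where "A = word_at s\<^sub>0 [a 0, a 1]"
  define B where "B = word_at s\<^sub>0 [b 0, b 1]"
  \<comment> \<open>A quarter that differs from \<open>A\<close> in the first letter and from
    \<open>B\<close> in the second, hence disjoint from both, even when \<open>A\<close> and
    \<open>B\<close> are equal.\<close>
  define C where "C = word_at s\<^sub>0 [\<not> a 0, \<not> b 1]"
  have ABC: "A \<in> addresses" "B \<in> addresses" "C \<in> addresses"
    using base by (simp_all add: A_def B_def C_def)
  have "apart A C" "apart A (half True)"
    unfolding A_def C_def apart_word_at by (rule exI[of _ 0]; simp add: a0)+
  moreover have "apart C B"
    unfolding B_def C_def apart_word_at by (rule exI[of _ 1]) simp
  moreover have "z \<in> range (graft A)" "F z \<in> range (graft B)"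
    unfolding range_graft by (auto simp: A_def B_def a_def b_def word_at_def less_Suc_eq)
  moreover from this obtain \<chi> \<phi> g where *: "\<chi> \<in> addresses" "\<phi> \<in> addresses" "g \<in> carrier G"
    "F \<circ> graft (A \<star> \<chi>) = graft (B \<star> \<phi>) \<circ> twist g"
    using V_local[OF F ABC(1) _ ABC(2), of z] by metis
  moreover define Q where "Q = A \<star> \<chi>"
  moreover define R where "R = B \<star> \<phi>"
  ultimately have Q: "Q \<in> addresses" "apart Q C" "apart Q (half True)"
    and R: "R \<in> addresses" "apart C R" and FQ: "F \<circ> graft Q = graft R \<circ> twist g"
    using ABC by (simp_all add: apart_extend)
  define E where "E = emb R (twist g)"
  have E: "E \<in> V"
    using R *(3) by (simp add: E_def)
  \<comment> \<open>\<open>Q\<close> and its image \<open>R\<close> may overlap, so \<open>Q\<close>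
    travels to \<open>R\<close> by way of \<open>C\<close>. Conjugation by \<open>E\<close>, which
    fixes \<open>C\<close>, adds the twist by g on arrival at \<open>R\<close> and keeps the second
    transposition a commutator.\<close>
  define M where "M = (E \<circ> swp C R \<circ> invf E) \<circ> swp Q C"
  have "swp C R \<in> V" "swp Q C \<in> V"
    using Q R ABC by simp_all
  then have M: "M \<in> V"
    using E by (simp add: M_def)
  have "V.commutator_product (1 + 1)
      ((E \<otimes>\<^bsub>V_group\<^esub> swp C R \<otimes>\<^bsub>V_group\<^esub> inv\<^bsub>V_group\<^esub> E) \<otimes>\<^bsub>V_group\<^esub> swp Q C)"
    using E Q R ABC
    by (intro V.commutator_product_mult V.commutator_product_conj V.commutator_product_1 swp_commutator) simp_all
  then have M2: "V.commutator_product 2 M"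
    using E by (simp add: M_def numeral_2_eq_2)
  have MQ: "M \<circ> graft Q = graft R \<circ> twist g"
  proof
    fix x
    have "E (graft C x) = graft C x"
      using R by (simp add: E_def emb_apart apart_sym)
    then have "invf E (graft C x) = graft C x"
      using E by (metis V_invf_apply(1))
    then show "(M \<circ> graft Q) x = (graft R \<circ> twist g) x"
      by (simp add: M_def E_def)
  qed
  \<comment> \<open>Conjugation by \<open>U\<close> turns the pointwise fixed brick \<open>Q\<close>
    into the half 1, so the support moves into the half 0.\<close>
  define U where "U = (swp Q (half True) :: ('s, 'a) point \<Rightarrow> _)"
  have U: "U \<in> V"
    using Q by (simp add: U_def)
  define F' where "F' = U \<circ> (invf M \<circ> F) \<circ> invf U"
  have F': "F' \<in> V"
    using F M U by (simp add: F'_def)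
  have "F' w = w" if w0: "w \<notin> range (graft (half False))" for w
  proof -
    obtain y where w: "w = graft (half True) y"
      using w0 halves_cover[of w s\<^sub>0] by blast
    then have "w = U (graft Q y)"
      by (simp add: U_def)
    moreover have "invf M (F (graft Q y)) = graft Q y"
      using fun_cong[OF FQ, of y] fun_cong[OF MQ, of y] M by (metis V_invf_apply(1) comp_apply)
    ultimately show ?thesis
      using U by (simp add: F'_def)
  qed
  then obtain Y where Y: "Y \<in> V" "F' = emb (half False) Y"
    using supported_in_brick[OF F' half_address] by metis
  have "V.commutator_product 2 F'"
    using halves.commutator_product_half[of Y] V_perfect[OF Y(1)] Y(2) by simp
  then have "V.commutator_product (2 + 2)
      (M \<otimes>\<^bsub>V_group\<^esub> (inv\<^bsub>V_group\<^esub> U \<otimes>\<^bsub>V_group\<^esub> F' \<otimes>\<^bsub>V_group\<^esub> inv\<^bsub>V_group\<^esub> (inv\<^bsub>V_group\<^esub> U)))"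
    using M2 U by (intro V.commutator_product_mult V.commutator_product_conj) simp_all
  moreover have "M \<circ> (invf U \<circ> F' \<circ> U) = F"
    using M U F by (auto simp: F'_def)
  ultimately show ?thesis
    using U by (simp add: inv_inv_eq V_bij)
qed

end

section \<open>Transfer to the twisted Brin--Thompson group\<close>

text \<open>\<open>B\<close> is not assumed to be a group: as a multiplicative image of
  \<open>A\<close> it becomes one, so the group axioms of the pairs (h, \<gamma>) follow from those
  of \<open>V_group\<close>.\<close>

lemma uniformly_perfect_epi:
  assumes "group A" and f: "f \<in> hom A B" "f ` carrier A = carrier B" "f \<one>\<^bsub>A\<^esub> = \<one>\<^bsub>B\<^esub>"
    and perfect: "\<And>x. x \<in> carrier A \<Longrightarrow> group.commutator_product A n x"
  shows "uniformly_perfect n B"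
proof -
  interpret A: group A by fact
  have "group (B\<lparr>carrier := f ` carrier A, one := f \<one>\<^bsub>A\<^esub>\<rparr>)"
    using f(1) by (rule A.hom_imp_img_group)
  then have B: "group B"
    by (simp add: f(2,3))
  interpret B: group B by fact
  interpret f: group_hom A B f
    using f(1) by unfold_locales
  have "\<exists>cs. length cs = n \<and> set cs \<subseteq> derived_set B (carrier B) \<and> y = foldr (\<otimes>\<^bsub>B\<^esub>) cs \<one>\<^bsub>B\<^esub>"
    if y: "y \<in> carrier B" for y
  proof -
    obtain x where x: "x \<in> carrier A" "y = f x"
      using f(2) y by blast
    obtain cs where cs: "length cs = n" "set cs \<subseteq> derived_set A (carrier A)" "x = foldr (\<otimes>\<^bsub>A\<^esub>) cs \<one>\<^bsub>A\<^esub>"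
      using perfect[OF x(1)] unfolding A.commutator_product_def by blast
    have "f c \<in> derived_set B (carrier B)" if c: "c \<in> set cs" for c
    proof -
      obtain a b where "a \<in> carrier A" "b \<in> carrier A"
        "c = a \<otimes>\<^bsub>A\<^esub> b \<otimes>\<^bsub>A\<^esub> inv\<^bsub>A\<^esub> a \<otimes>\<^bsub>A\<^esub> inv\<^bsub>A\<^esub> b"
        using subsetD[OF cs(2) c] by auto
      then show ?thesis
        by (intro B.derived_setI[of "f a" "f b"]) simp_all
    qed
    then have "set (map f cs) \<subseteq> derived_set B (carrier B)"
      unfolding set_map by (rule image_subsetI)
    moreover have "f (foldr (\<otimes>\<^bsub>A\<^esub>) cs \<one>\<^bsub>A\<^esub>) = foldr (\<otimes>\<^bsub>B\<^esub>) (map f cs) \<one>\<^bsub>B\<^esub>"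
      using subset_trans[OF cs(2) A.derived_set_in_carrier[OF subset_refl]]
      by (induction cs) (simp_all add: f(3) A.foldr_mult_closed)
    ultimately show ?thesis
      using cs(1,3) x(2) by (intro exI[of _ "map f cs"]) (simp only: length_map)
  qed
  then show ?thesis
    using B unfolding uniformly_perfect_def by blast
qed

section \<open>From permutations of labelled points to pairs (h, \<gamma>)\<close>

lemma prefix_eq_iff:
  "Omega_Words_Fun.prefix (length u) w = u \<longleftrightarrow> (\<forall>i<length u. w i = u ! i)"
  unfolding subsequence_def list_eq_iff_nth_eq by simp

context twisted_cube
begin

abbreviation "\<T> \<equiv> twisted_brin_thompson G S act"

text \<open>As \<open>F\<close> sends (\<kappa>, x) to (h \<kappa>, \<gamma>(\<kappa>) x) for x in
  \<open>G\<close>, the label 1 makes \<gamma> readable.\<close>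

definition labelled :: "(('s, 'a) point \<Rightarrow> ('s, 'a) point) \<Rightarrow>
    (('s \<Rightarrow> bool word) \<Rightarrow> ('s \<Rightarrow> bool word)) \<times> (('s \<Rightarrow> bool word) \<Rightarrow> 'a)"
  where "labelled F = (\<lambda>\<kappa>\<in>cube S. fst (F (\<kappa>, \<one>)), \<lambda>\<kappa>\<in>cube S. snd (F (\<kappa>, \<one>)))"

lemma V_apply:
  assumes F: "F \<in> V"
  shows "s \<notin> S \<Longrightarrow> fst (F (\<kappa>, x)) s = \<kappa> s"
    and "snd (F (\<kappa>, \<one>)) \<in> carrier G"
    and "x \<in> carrier G \<Longrightarrow> F (\<kappa>, x) = (fst (F (\<kappa>, \<one>)), snd (F (\<kappa>, \<one>)) \<otimes> x)"
proof -
  obtain \<alpha> \<beta> g where *: "\<alpha> \<in> addresses" "(\<kappa>, \<one>) \<in> range (graft \<alpha>)" "\<beta> \<in> addresses" "g \<in> carrier G"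
    "F \<circ> graft \<alpha> = graft \<beta> \<circ> twist g"
    by (rule V_local[OF F, of triv "(\<kappa>, \<one>)" triv]) auto
  then obtain \<mu> where \<kappa>: "\<kappa> = (\<lambda>s. \<alpha> s \<frown> \<mu> s)"
    by (auto simp: graft_def)
  have F': "F (\<kappa>, x) = graft \<beta> (twist g (\<mu>, x))" for x
    using fun_cong[OF *(5), of "(\<mu>, x)"] by (simp add: \<kappa> graft_def)
  have out: "\<alpha> s = []" "\<beta> s = []" if "s \<notin> S" for s
    using that * by (auto simp: addresses_def)
  show "s \<notin> S \<Longrightarrow> fst (F (\<kappa>, x)) s = \<kappa> s"
    unfolding F' by (simp add: graft_def twist_def move_def out \<kappa>)
  show "snd (F (\<kappa>, \<one>)) \<in> carrier G"
    using * unfolding F' by (simp add: graft_def twist_def)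
  show "x \<in> carrier G \<Longrightarrow> F (\<kappa>, x) = (fst (F (\<kappa>, \<one>)), snd (F (\<kappa>, \<one>)) \<otimes> x)"
    using * unfolding F' by (simp add: graft_def twist_def)
qed

lemma V_cube: "F \<in> V \<Longrightarrow> \<kappa> \<in> cube S \<Longrightarrow> fst (F (\<kappa>, x)) \<in> cube S"
  using V_apply(1)[of F] by (auto simp: cube_def PiE_def extensional_def)

lemma labelled_comp:
  assumes F: "F \<in> V" and H: "H \<in> V"
  shows "labelled (F \<circ> H) = labelled F \<otimes>\<^bsub>\<T>\<^esub> labelled H"
proof -
  have "F (H (\<kappa>, \<one>)) = (fst (F (fst (H (\<kappa>, \<one>)), \<one>)), snd (F (fst (H (\<kappa>, \<one>)), \<one>)) \<otimes> snd (H (\<kappa>, \<one>)))" for \<kappa>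
    using V_apply(3)[OF F V_apply(2)[OF H], of "fst (H (\<kappa>, \<one>))" \<kappa>] by simp
  then show ?thesis
    using V_cube[OF H]
    by (auto simp: labelled_def twisted_brin_thompson_def compose_def intro!: restrict_ext)
qed

lemma labelled_id: "labelled id = \<one>\<^bsub>\<T>\<^esub>"
  by (simp add: labelled_def twisted_brin_thompson_def)

lemma brick_iff:
  assumes "\<beta> \<in> addresses"
  shows "\<kappa> \<in> brick S \<beta> \<longleftrightarrow> \<kappa> \<in> cube S \<and> (\<kappa>, x) \<in> range (graft \<beta>)"
proof -
  have "\<beta> s = []" if "s \<notin> S" for s
    using assms that by (auto simp: addresses_def)
  then have "(\<forall>s. \<forall>i<length (\<beta> s). \<kappa> s i = \<beta> s ! i) \<longleftrightarrow> (\<forall>s\<in>S. \<forall>i<length (\<beta> s). \<kappa> s i = \<beta> s ! i)"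
    by (metis less_nat_zero_code list.size(3))
  then show ?thesis
    by (simp add: brick_def range_graft prefix_eq_iff)
qed

lemma partition_dyadic:
  assumes K: "brick_partition K" and \<psi>: "bij_betw \<psi> {..<n} K"
  shows "dyadic_partition S n \<psi>"
proof -
  have \<psi>K: "\<psi> i \<in> K" "\<psi> i \<in> addresses" if "i < n" for i
    using bij_betwE[OF \<psi>] that brick_partitionD(2)[OF K] by auto
  have "address S (\<psi> i)" if "i < n" for i
    using \<psi>K(2)[OF that] by (auto simp: addresses_def address_def elim: rev_finite_subset)
  moreover have "brick S (\<psi> i) \<inter> brick S (\<psi> j) = {}" if "i < n" "j < n" "i \<noteq> j" for i j
  proof -
    have "\<psi> i \<noteq> \<psi> j"
      using \<psi> that by (auto simp: bij_betw_def inj_on_def)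
    then have "apart (\<psi> i) (\<psi> j)"
      using brick_partitionD(3)[OF K] \<psi>K that by blast
    then have disjoint: "range (graft (\<psi> i) :: ('s, 'a) point \<Rightarrow> _) \<inter> range (graft (\<psi> j)) = {}"
      by (rule apart_iff_disjoint[THEN iffD1])
    have "(\<kappa>, \<one>) \<in> range (graft (\<psi> i)) \<inter> range (graft (\<psi> j))"
      if "\<kappa> \<in> brick S (\<psi> i) \<inter> brick S (\<psi> j)" for \<kappa>
      using that \<psi>K(2) \<open>i < n\<close> \<open>j < n\<close> by (simp add: brick_iff[where x = \<one>])
    then show ?thesis
      unfolding disjoint by blast
  qed
  moreover have "\<kappa> \<in> (\<Union>i<n. brick S (\<psi> i))" if \<kappa>: "\<kappa> \<in> cube S" for \<kappa>
  proof -
    obtain \<beta> where "\<beta> \<in> K" "(\<kappa>, \<one>) \<in> range (graft \<beta>)"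
      using brick_partitionD(4)[OF K] by blast
    moreover from this obtain i where "i < n" "\<beta> = \<psi> i"
      using \<psi> by (auto simp: bij_betw_def)
    ultimately show ?thesis
      using \<psi>K(2) \<kappa> by (auto simp: brick_iff[where x = \<one>])
  qed
  moreover have "brick S (\<psi> i) \<subseteq> cube S" for i
    by (auto simp: brick_def)
  ultimately show ?thesis
    unfolding dyadic_partition_def disjoint_family_on_def by blast
qed

lemma brick_map_graft: "\<beta> \<in> addresses \<Longrightarrow> \<kappa> \<in> cube S \<Longrightarrow> graft \<beta> (\<kappa>, x) = (brick_map S \<beta> \<kappa>, x)"
proof -
  assume "\<beta> \<in> addresses" "\<kappa> \<in> cube S"
  then have "\<beta> s = []" "\<kappa> s = undefined" if "s \<notin> S" for s
    using that by (auto simp: addresses_def cube_def PiE_def extensional_def)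
  then have "\<beta> s \<frown> \<kappa> s = brick_map S \<beta> \<kappa> s" for s
    by (simp add: brick_map_def)
  then show ?thesis
    by (simp add: graft_def)
qed

lemma cube_action_twist:
  assumes "g \<in> carrier G" "\<kappa> \<in> cube S" "x \<in> carrier G"
  shows "twist g (\<kappa>, x) = (cube_action G S act g \<kappa>, g \<otimes> x)"
  using assms
  by (auto simp: twist_def cube_action_def move_def cube_def PiE_def extensional_def fun_eq_iff)

lemma cube_action_cube: "cube_action G S act g \<kappa> \<in> cube S"
  by (simp add: cube_action_def cube_def)

lemma brick_map_cube: "brick_map S \<beta> \<kappa> \<in> cube S"
  by (simp add: brick_map_def cube_def)

lemma topspace_cube [simp]: "topspace (cube_topology S) = cube S"
  by (simp add: cube_topology_def cube_def)

lemma openin_brick: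
  assumes "\<beta> \<in> addresses" shows "openin (cube_topology S) (brick S \<beta>)"
proof -
  have "finite {s. {w. \<forall>i<length (\<beta> s). w i = \<beta> s ! i} \<noteq> (UNIV :: bool word set)}"
    using assms by (auto simp: addresses_def elim!: rev_finite_subset)
  then have "openin (cube_topology S) (\<Pi>\<^sub>E s\<in>S. {w. \<forall>i<length (\<beta> s). w i = \<beta> s ! i})"
    unfolding cube_topology_def by (intro product_topology_basis) (simp_all add: open_cylinder)
  also have "(\<Pi>\<^sub>E s\<in>S. {w. \<forall>i<length (\<beta> s). w i = \<beta> s ! i}) = brick S \<beta>"
    by (auto simp: brick_def cube_def PiE_iff extensional_def prefix_eq_iff)
  finally show ?thesis .
qed

text \<open>By the product topology it suffices that each single letter of the image is locally
  constant, and a local table entry fixes any given letter on a whole brick.\<close>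

lemma labelled_continuous:
  assumes F: "F \<in> V"
  shows "continuous_map (cube_topology S) (cube_topology S) (fst (labelled F))"
proof -
  let ?h = "fst (labelled F)"
  have h: "?h \<kappa> = fst (F (\<kappa>, \<one>))" if "\<kappa> \<in> cube S" for \<kappa>
    using that by (simp add: labelled_def)
  have "continuous_map (cube_topology S) euclidean (\<lambda>\<kappa>. ?h \<kappa> s n)" if s: "s \<in> S" for s n
    unfolding continuous_map_def
  proof (intro conjI allI impI)
    fix U :: "bool set"
    show "openin (cube_topology S) {\<kappa> \<in> topspace (cube_topology S). ?h \<kappa> s n \<in> U}"
    proof (subst openin_subopen, intro ballI)
      fix \<kappa> assume "\<kappa> \<in> {\<kappa> \<in> topspace (cube_topology S). ?h \<kappa> s n \<in> U}"
      then have \<kappa>: "\<kappa> \<in> cube S" "?h \<kappa> s n \<in> U"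
        by auto
      \<comment> \<open>The first n+1 letters of the image at s, so that letter n is among
        them.\<close>
      define \<beta> where "\<beta> = word_at s (map (?h \<kappa> s) [0..<Suc n])"
      have "F (\<kappa>, \<one>) \<in> range (graft \<beta>)"
        unfolding range_graft by (auto simp: \<beta>_def word_at_def h[OF \<kappa>(1)] simp del: upt_Suc)
      moreover have "\<beta> \<in> addresses"
        using s by (simp add: \<beta>_def del: upt_Suc)
      ultimately obtain \<chi> \<phi> g where *: "\<chi> \<in> addresses" "(\<kappa>, \<one>) \<in> range (graft \<chi>)"
        "F \<circ> graft \<chi> = graft (\<beta> \<star> \<phi>) \<circ> twist g"
        by - (rule V_local[OF F addresses_triv, of "(\<kappa>, \<one>)" \<beta>]; simp)
      have "?h \<mu> s n = ?h \<kappa> s n" if \<mu>: "\<mu> \<in> brick S \<chi>" for \<mu>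
      proof -
        obtain y where y: "(\<mu>, \<one>) = graft \<chi> y"
          using \<mu> brick_iff[OF *(1), of \<mu> \<one>] by blast
        have "F (\<mu>, \<one>) = graft \<beta> (graft \<phi> (twist g y))"
          using fun_cong[OF *(3), of y] by (simp add: y graft_cat)
        then have "fst (F (\<mu>, \<one>)) s n = \<beta> s ! n"
          by (simp add: graft_def \<beta>_def word_at_def nth_append del: upt_Suc)
        moreover have "\<mu> \<in> cube S"
          using \<mu> by (simp add: brick_def)
        ultimately show ?thesis
          by (simp add: h \<beta>_def word_at_def del: upt_Suc)
      qed
      then have "brick S \<chi> \<subseteq> {\<kappa> \<in> topspace (cube_topology S). ?h \<kappa> s n \<in> U}"
        using \<kappa> by (auto simp: brick_def)
      moreover have "\<kappa> \<in> brick S \<chi>"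
        using *(1,2) \<kappa>(1) brick_iff[of \<chi> \<kappa> \<one>] by blast
      ultimately show "\<exists>W. openin (cube_topology S) W \<and> \<kappa> \<in> W \<and> W \<subseteq> {\<kappa> \<in> topspace (cube_topology S). ?h \<kappa> s n \<in> U}"
        using openin_brick[OF *(1)] by blast
    qed
  qed simp
  then have "continuous_map (cube_topology S) euclidean (\<lambda>\<kappa>. ?h \<kappa> s)" if "s \<in> S" for s
    using that unfolding euclidean_product_topology[symmetric, where 'a = nat]
    by (simp add: continuous_map_componentwise_UNIV)
  moreover have "?h ` cube S \<subseteq> extensional S"
    using V_cube[OF F] by (auto simp: h cube_def PiE_def)
  ultimately show ?thesis
    unfolding cube_topology_def[of S] continuous_map_componentwise
    by (simp add: cube_topology_def[symmetric])
qed

lemma labelled_homeomorphic: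
  assumes F: "F \<in> V"
  shows "homeomorphic_map (cube_topology S) (cube_topology S) (fst (labelled F))"
proof -
  have inverse: "fst (labelled F') (fst (labelled H) \<kappa>) = \<kappa>"
    if "F' \<in> V" "H \<in> V" "F' \<circ> H = id" "\<kappa> \<in> cube S" for F' H \<kappa>
  proof -
    have "fst (labelled (F' \<circ> H)) \<kappa> = fst (labelled F') (fst (labelled H) \<kappa>)"
      unfolding labelled_comp[OF that(1,2)] using that(4)
      by (simp add: twisted_brin_thompson_def split_beta compose_def)
    then show ?thesis
      using that(3,4) by (simp add: labelled_def)
  qed
  have "homeomorphic_maps (cube_topology S) (cube_topology S) (fst (labelled F)) (fst (labelled (invf F)))"
    using F by (simp add: homeomorphic_maps_def labelled_continuous inverse)
  then show ?thesis
    unfolding homeomorphic_map_maps by blast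
qed

lemma labelled_in_carrier:
  assumes F: "F \<in> V" shows "labelled F \<in> carrier \<T>"
proof -
  obtain K p where K: "brick_partition K" and p: "\<And>\<beta>. \<beta> \<in> K \<Longrightarrow> p \<beta> \<in> addresses \<and> carries F \<beta> (p \<beta>)"
    using canonical_table[OF F] by metis
  obtain q where q: "\<And>\<beta>. \<beta> \<in> K \<Longrightarrow> q \<beta> \<in> carrier G \<and> F \<circ> graft \<beta> = graft (p \<beta>) \<circ> twist (q \<beta>)"
    using p unfolding carries_def by metis
  obtain \<psi> where \<psi>: "bij_betw \<psi> {..<card K} K"
    using ex_bij_betw_nat_finite[OF brick_partitionD(1)[OF K]] by (auto simp: atLeast0LessThan)
  have "inj_on p K"
    using carries_source_unique[OF F K] p by (metis inj_onI)
  then have "bij_betw p K (p ` K)"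
    by (rule inj_on_imp_bij_betw)
  then have "bij_betw (p \<circ> \<psi>) {..<card K} (p ` K)"
    using \<psi> by (rule bij_betw_trans[rotated])
  then have "dyadic_partition S (card K) (p \<circ> \<psi>)" "dyadic_partition S (card K) \<psi>"
    using \<psi> K partition_image[OF F K p] by (auto intro: partition_dyadic)
  moreover have "q (\<psi> i) \<in> carrier G \<and>
      (\<forall>\<kappa>\<in>cube S. fst (labelled F) (brick_map S (\<psi> i) \<kappa>) =
        brick_map S (p (\<psi> i)) (cube_action G S act (q (\<psi> i)) \<kappa>) \<and>
        snd (labelled F) (brick_map S (\<psi> i) \<kappa>) = q (\<psi> i))"
    if "i < card K" for i
  proof (intro conjI ballI)
    have \<psi>i: "\<psi> i \<in> K" "\<psi> i \<in> addresses"
      using bij_betwE[OF \<psi>] that brick_partitionD(2)[OF K] by auto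
    show q': "q (\<psi> i) \<in> carrier G"
      using q \<psi>i by blast
    fix \<kappa> assume \<kappa>: "\<kappa> \<in> cube S"
    have "F (brick_map S (\<psi> i) \<kappa>, \<one>) = graft (p (\<psi> i)) (twist (q (\<psi> i)) (\<kappa>, \<one>))"
      using q[OF \<psi>i(1)] \<psi>i \<kappa> by (metis brick_map_graft comp_apply)
    also have "\<dots> = (brick_map S (p (\<psi> i)) (cube_action G S act (q (\<psi> i)) \<kappa>), q (\<psi> i))"
      using p[OF \<psi>i(1)] q' \<kappa> by (simp add: cube_action_twist brick_map_graft cube_action_cube)
    finally show "fst (labelled F) (brick_map S (\<psi> i) \<kappa>) =
          brick_map S (p (\<psi> i)) (cube_action G S act (q (\<psi> i)) \<kappa>)"
        "snd (labelled F) (brick_map S (\<psi> i) \<kappa>) = q (\<psi> i)"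
      by (simp_all add: labelled_def brick_map_cube)
  qed
  moreover have "fst (labelled F) \<in> extensional (cube S)" "snd (labelled F) \<in> cube S \<rightarrow>\<^sub>E carrier G"
    using V_apply(2)[OF F] by (simp_all add: labelled_def)
  ultimately show ?thesis
    using labelled_homeomorphic[OF F] unfolding twisted_brin_thompson_def partial_object.simps
    by (subst surjective_pairing[of "labelled F"], unfold mem_Collect_eq prod.case)
      (intro conjI exI[of _ "card K"] exI[of _ \<psi>] exI[of _ "p \<circ> \<psi>"] exI[of _ "q \<circ> \<psi>"]; simp)
qed

text \<open>A pair is extended to all points by leaving coordinates outside S and labels outside
  \<open>G\<close> unchanged; its finite table then provides the local entries required by
  \<open>V\<close>.\<close>

lemma labelled_surj:
  assumes "t \<in> carrier \<T>" shows "\<exists>F\<in>V. labelled F = t"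
proof -
  obtain h \<gamma> where t: "t = (h, \<gamma>)"
    by (rule prod.exhaust)
  with assms have h_ext: "h \<in> extensional (cube S)"
    and hom: "homeomorphic_map (cube_topology S) (cube_topology S) h"
    and \<gamma>: "\<gamma> \<in> cube S \<rightarrow>\<^sub>E carrier G"
    and "\<exists>n \<psi> \<phi> g. dyadic_partition S n \<psi> \<and> dyadic_partition S n \<phi> \<and>
          (\<forall>i<n. g i \<in> carrier G \<and>
             (\<forall>\<kappa>\<in>cube S.
                h (brick_map S (\<psi> i) \<kappa>) = brick_map S (\<phi> i) (cube_action G S act (g i) \<kappa>) \<and>
                \<gamma> (brick_map S (\<psi> i) \<kappa>) = g i))"
    unfolding twisted_brin_thompson_def by simp_all
  then obtain n \<psi> \<phi> g where dy: "dyadic_partition S n \<psi>" "dyadic_partition S n \<phi>"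
    and g: "\<And>i. i < n \<Longrightarrow> g i \<in> carrier G"
    and table: "\<And>i \<kappa>. i < n \<Longrightarrow> \<kappa> \<in> cube S \<Longrightarrow>
      h (brick_map S (\<psi> i) \<kappa>) = brick_map S (\<phi> i) (cube_action G S act (g i) \<kappa>) \<and>
      \<gamma> (brick_map S (\<psi> i) \<kappa>) = g i"
    by blast
  have h: "h ` cube S = cube S" "inj_on h (cube S)"
    using hom unfolding homeomorphic_eq_everything_map by simp_all
  define r where "r \<kappa> = (\<lambda>s\<in>S. \<kappa> s)" for \<kappa> :: "'s \<Rightarrow> bool word"
  have r: "r \<kappa> \<in> cube S" for \<kappa>
    by (simp add: r_def cube_def)
  have r_id: "r \<kappa> = \<kappa>" if "\<kappa> \<in> cube S" for \<kappa>
    using that by (auto simp: r_def cube_def PiE_def extensional_restrict)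
  have \<gamma>r: "\<gamma> (r \<kappa>) \<in> carrier G" for \<kappa>
    using \<gamma> r by blast
  \<comment> \<open>Addresses in a dyadic partition are arbitrary outside S; emptying them there
    gives members of \<open>addresses\<close> with the same bricks.\<close>
  define cut where "cut \<beta> = (\<lambda>s. if s \<in> S then \<beta> s else [])" for \<beta> :: "'s \<Rightarrow> bool list"
  have cut: "cut \<beta> \<in> addresses" if "address S \<beta>" for \<beta>
    using that by (auto simp: address_def addresses_def cut_def if_distrib conj_commute cong: rev_conj_cong elim: rev_finite_subset)
  have brick_cut: "brick S (cut \<beta>) = brick S \<beta>" for \<beta>
    by (auto simp: brick_def cut_def)
  define F where "F z = (\<lambda>s. if s \<in> S then h (r (fst z)) s else fst z s,
      if snd z \<in> carrier G then \<gamma> (r (fst z)) \<otimes> snd z else snd z)" for z :: "('s, 'a) point"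
  have F_graft: "F \<circ> graft (cut (\<psi> i)) = graft (cut (\<phi> i)) \<circ> twist (g i)" if i: "i < n" for i
  proof
    fix z :: "('s, 'a) point"
    have "r (fst (graft (cut (\<psi> i)) z)) = brick_map S (\<psi> i) (r (fst z))"
      by (auto simp: r_def graft_def cut_def brick_map_def)
    moreover have "snd (graft (cut (\<psi> i)) z) = snd z"
      by (simp add: graft_def)
    moreover have "h (brick_map S (\<psi> i) (r (fst z))) s = \<phi> i s \<frown> fst z (act (inv (g i)) s)" if "s \<in> S" for s
      using table[OF i r, of "fst z"] that g[OF i]
      by (simp add: brick_map_def cube_action_def r_def act_closed)
    moreover have "\<gamma> (brick_map S (\<psi> i) (r (fst z))) = g i"
      using table[OF i r] by blast
    ultimately have "F (graft (cut (\<psi> i)) z) =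
        (\<lambda>s. if s \<in> S then \<phi> i s \<frown> fst z (act (inv (g i)) s) else fst (graft (cut (\<psi> i)) z) s,
          if snd z \<in> carrier G then g i \<otimes> snd z else snd z)"
      by (simp add: F_def cong: if_cong)
    then show "(F \<circ> graft (cut (\<psi> i))) z = (graft (cut (\<phi> i)) \<circ> twist (g i)) z"
      by (auto simp: graft_def cut_def twist_def move_def)
  qed
  have "bij F"
  proof (rule bijI)
    show "inj F"
    proof (rule injI)
      fix y z assume eq: "F y = F z"
      have "h (r (fst y)) s = h (r (fst z)) s" for s
      proof (cases "s \<in> S")
        case True
        then show ?thesis
          using eq by (auto simp: F_def dest: fun_cong[of _ _ s])
      next
        case False
        moreover have "h (r (fst y)) \<in> cube S" "h (r (fst z)) \<in> cube S"
          using h r by blast+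
        ultimately show ?thesis
          by (simp add: cube_def PiE_def extensional_def)
      qed
      then have "h (r (fst y)) = h (r (fst z))"
        by (rule ext)
      then have "r (fst y) = r (fst z)"
        by (rule inj_onD[OF h(2) _ r r])
      moreover have "fst y s = fst z s" for s
      proof (cases "s \<in> S")
        case True
        then show ?thesis
          using fun_cong[OF \<open>r (fst y) = r (fst z)\<close>, of s] by (simp add: r_def)
      next
        case False
        then show ?thesis
          using eq by (auto simp: F_def dest: fun_cong[of _ _ s])
      qed
      moreover have "snd y = snd z"
        using eq \<gamma>r \<open>r (fst y) = r (fst z)\<close> by (auto simp: F_def split: if_splits) (metis m_closed)+
      ultimately show "y = z"
        by (auto simp: prod_eq_iff)
    qed
    have "\<exists>y. F y = z" for z
    proof -
      obtain \<kappa> where \<kappa>: "\<kappa> \<in> cube S" "h \<kappa> = r (fst z)"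
        using h(1) r by (metis imageE)
      \<comment> \<open>The preimage combines the preimage under h inside S with the untouched
        coordinates of z outside S.\<close>
      define \<mu> where "\<mu> s = (if s \<in> S then \<kappa> s else fst z s)" for s
      have "r \<mu> = r \<kappa>"
        unfolding r_def by (rule restrict_ext) (simp add: \<mu>_def)
      then have "r \<mu> = \<kappa>"
        by (simp only: r_id[OF \<kappa>(1)])
      moreover have "(\<lambda>s. if s \<in> S then h \<kappa> s else \<mu> s) = fst z"
        unfolding \<kappa>(2) by (auto simp: r_def \<mu>_def)
      moreover have "\<gamma> \<kappa> \<in> carrier G"
        using \<gamma> \<kappa>(1) by blast
      ultimately have "F (\<mu>, if snd z \<in> carrier G then inv (\<gamma> \<kappa>) \<otimes> snd z else snd z) = z"
        by (simp add: F_def prod_eq_iff cong: if_cong)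
      then show ?thesis ..
    qed
    then show "surj F"
      by (metis surjI)
  qed
  moreover have "\<exists>\<alpha>\<in>addresses. z \<in> range (graft \<alpha>) \<and> canonical F \<alpha>" for z :: "('s, 'a) point"
  proof -
    obtain i where i: "i < n" "r (fst z) \<in> brick S (\<psi> i)"
      using dy(1) r[of "fst z"] unfolding dyadic_partition_def by blast
    have ad: "cut (\<psi> i) \<in> addresses" "cut (\<phi> i) \<in> addresses"
      using dy i(1) cut by (auto simp: dyadic_partition_def)
    have "(r (fst z), snd z) \<in> range (graft (cut (\<psi> i)))"
      using i(2) brick_iff[OF ad(1), of "r (fst z)" "snd z"] unfolding brick_cut by blast
    then have r_eq: "r (fst z) s k = cut (\<psi> i) s ! k" if "k < length (cut (\<psi> i) s)" for s k
      using that unfolding range_graft by simp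
    have "fst z s k = cut (\<psi> i) s ! k" if k: "k < length (cut (\<psi> i) s)" for s k
    proof -
      have "s \<in> S"
        using k by (auto simp: cut_def split: if_splits)
      then show ?thesis
        using r_eq[OF k] by (simp add: r_def)
    qed
    then have "z \<in> range (graft (cut (\<psi> i)))"
      unfolding range_graft by blast
    then show ?thesis
      using ad canonicalI[OF ad(2) g[OF i(1)] F_graft[OF i(1)]] by blast
  qed
  ultimately have "F \<in> V"
    by (rule V_I)
  moreover have "labelled F = t"
  proof -
    have "(\<lambda>s. if s \<in> S then h \<kappa> s else \<kappa> s) = h \<kappa>" if \<kappa>: "\<kappa> \<in> cube S" for \<kappa>
    proof -
      have "h \<kappa> \<in> cube S"
        using h(1) \<kappa> by blast
      then show ?thesis
        using \<kappa> by (auto simp: cube_def PiE_def extensional_def fun_eq_iff)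
    qed
    then have "(\<lambda>\<kappa>\<in>cube S. fst (F (\<kappa>, \<one>))) = h"
      using h_ext by (intro extensionalityI[of _ "cube S"]) (simp_all add: F_def r_id cong: if_cong)
    moreover have "(\<lambda>\<kappa>\<in>cube S. snd (F (\<kappa>, \<one>))) = \<gamma>"
    proof (rule extensionalityI[of _ "cube S"])
      show "\<gamma> \<in> extensional (cube S)"
        using \<gamma> by (simp add: PiE_def)
      fix \<kappa> assume \<kappa>: "\<kappa> \<in> cube S"
      then have "\<gamma> \<kappa> \<in> carrier G"
        using \<gamma> by blast
      then show "(\<lambda>\<kappa>\<in>cube S. snd (F (\<kappa>, \<one>))) \<kappa> = \<gamma> \<kappa>"
        using \<kappa> by (simp add: F_def r_id)
    qed simp
    ultimately show ?thesis
      by (simp add: labelled_def t)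
  qed
  ultimately show ?thesis
    by blast
qed

lemma uniformly_perfect_twisted: "uniformly_perfect 5 \<T>"
proof (rule uniformly_perfect_epi)
  show "group V_group"
    by (rule V.group_axioms)
  show "labelled \<in> hom V_group \<T>"
    by (rule homI) (simp_all only: V_group_simps labelled_in_carrier labelled_comp)
  show "labelled ` carrier V_group = carrier \<T>"
    unfolding V_group_simps(1) using labelled_in_carrier labelled_surj by blast
  show "labelled \<one>\<^bsub>V_group\<^esub> = \<one>\<^bsub>\<T>\<^esub>"
    by (simp only: V_group_simps labelled_id)
  \<comment> \<open>Four commutators suffice; the fifth is the trivial one.\<close>
  show "V.commutator_product 5 F" if "F \<in> carrier V_group" for F
    using V.commutator_product_Suc[OF V_commutator_product, of F] that by (simp add: eval_nat_numeral)
qed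

end

theorem theorem6p2:
  fixes G :: "('g, 'm) monoid_scheme"
    and S :: "'s set"
    and act :: "'g \<Rightarrow> 's \<Rightarrow> 's"
  assumes "group G"
    and "group_action G S act"
    and "S \<noteq> {}"
  shows "uniformly_perfect 5 (twisted_brin_thompson G S act)"
proof -
  interpret group G by fact
  interpret group_action G S act by fact
  obtain s\<^sub>0 where "s\<^sub>0 \<in> S"
    using assms(3) by blast
  then interpret twisted_cube G S act s\<^sub>0
  proof unfold_locales
    show "act g s \<in> S" if "g \<in> carrier G" "s \<in> S" for g s
      by (rule element_image[OF that refl])
    show "act \<one>\<^bsub>G\<^esub> s = s" if "s \<in> S" for s
      using that by (simp flip: id_eq_one)
    show "act (g \<otimes>\<^bsub>G\<^esub> h) s = act g (act h s)" if "g \<in> carrier G" "h \<in> carrier G" "s \<in> S" for g h s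
      by (rule composition_rule[OF that(3,1,2)])
  qed
  show ?thesis
    by (rule uniformly_perfect_twisted)
qed

end
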